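(* Let $\Sigma_A^\ell$, $\mu$, $J$, $\Pi_\lambda$, $\nu_\lambda$ and $\phi_{\omega,\tau}$ be as described in the context. Let $\eta$ be a compactly supported Borel probability measure on $\mathbb{R}$ of exact local dimension $d_\eta$. Suppose that for any $\varepsilon>0$ there exists a subset $\Omega_\varepsilon\subset\Sigma_A^\ell$ with $\mu(\Omega_\varepsilon)>1-\varepsilon$ such that the following holds: there exist constants $C_1,C_2,C_3,\alpha,\beta,\gamma>0$ and $k_0\in\mathbb{Z}_+$ such that $$d_\eta+\frac{\gamma}{\beta}>1\quad\text{and}\quad d_\eta>\frac{\beta-\gamma}{\alpha};$$ $$\max_{\lambda\in J}|\phi_{\omega,\tau}(\lambda)|\le C_1\ell^{-\alpha|\omega\wedge\tau|}\quad\text{for all }\omega,\tau\in\Omega_\varepsilon,\ \omega\ne\tau;$$ $$\sup_{v\in\mathbb{R}}\mathcal{L}^1\big(\{\lambda\in J:\ |v+\phi_{\omega,\tau}(\lambda)|\le r\}\big)\le C_2\,\ell^{|\omega\wedge\tau|\beta}\,r\quad\text{for all } r>0 \text{ and all }\omega,\tau\in\Omega_\varepsilon,\ \omega\ne\tau,\text{ with }|\omega\wedge\tau|\ge k_0;$$ and $$\max_{u\in\mathcal{A}^n,\ [u]\cap\Omega_\varepsilon\ne\emptyset}\mu([u])\le C_3\ell^{-\gamma n}\quad\text{for all }n\ge1.$$ Then $\eta*\nu_\lambda$ is absolutely continuous with respect to $\mathcal{L}^1$ for Lebesgue-a.e. $\lambda\in J$.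
   Context: $\mathcal{L}^1$ is one-dimensional Lebesgue measure and $\mathbb{Z}_+=\{0,1,2,\ldots\}$. $\mathcal{A}$ is a finite alphabet with $|\mathcal{A}|=\ell\ge2$; $\mathcal{A}^{\mathbb{Z}_+}$ carries the product topology. $A$ is a primitive $0$--$1$ matrix of size $\ell\times\ell$ and $\Sigma_A^\ell\subset\mathcal{A}^{\mathbb{Z}_+}$ is the one-sided topological Markov chain: $\omega=\omega_0\omega_1\ldots\in\Sigma_A^\ell$ iff $A_{\omega_m\omega_{m+1}}=1$ for all $m\ge0$. $\mu$ is a Borel probability measure on $\Sigma_A^\ell$. $J=[\lambda_0,\lambda_1]\subset\mathbb{R}$ is a parameter interval, and $\Pi_\lambda:\Sigma_A^\ell\to\mathbb{R}$, $\lambda\in J$, is a family of continuous maps whose images $\Pi_\lambda(\Sigma_A^\ell)$ are Cantor sets; $\nu_\lambda=\mu\circ\Pi_\lambda^{-1}$. For a word $u\in\mathcal{A}^n$, $[u]=\{\omega\in\Sigma_A^\ell:\omega_0\ldots\omega_{n-1}=u\}$. For $\omega,\tau\in\Sigma_A^\ell$, $\omega\wedge\tau$ is their maximal common prefix, of length $|\omega\wedge\tau|$ (equal to $0$ if $\omega_0\ne\tau_0$), and $\phi_{\omega,\tau}(\lambda)=\Pi_\lambda(\omega)-\Pi_\lambda(\tau)$. $\eta$ has exact local dimension $d_\eta$ if $\lim_{r\downarrow0}\frac{\log\eta([x-r,x+r])}{\log r}=d_\eta$ for $\eta$-a.e. $x$. The sets $\Omega_\varepsilon$ are understood to be measurable,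 and the constants $C_1,C_2,C_3,\alpha,\beta,\gamma,k_0$ may depend on $\varepsilon$. *)

theory Defs
  imports "HOL-Probability.Probability"
begin

text \<open>
  The alphabet is a type of sort \<open>{finite, discrete_topology}\<close>, so that the topology
  of \<^typ>\<open>nat \<Rightarrow> 'a\<close> is the product topology of the discrete one and the library's
  \<^const>\<open>continuous_on\<close> and \<^const>\<open>borel\<close> apply to sequence spaces directly.
\<close>

definition matrix_power :: "real ^ 'a ^ 'a \<Rightarrow> nat \<Rightarrow> real ^ 'a ^ 'a" where
  "matrix_power A n = ((\<lambda>B. A ** B) ^^ n) (mat 1)"

definition zero_one_matrix :: "real ^ 'a ^ 'a \<Rightarrow> bool" where
  "zero_one_matrix A \<longleftrightarrow> (\<forall>i j. A $ i $ j \<in> {0, 1})"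

definition primitive_matrix :: "real ^ 'a ^ 'a \<Rightarrow> bool" where
  "primitive_matrix A \<longleftrightarrow>
     (\<forall>i j. A $ i $ j \<ge> 0) \<and> (\<exists>n\<ge>1. \<forall>i j. matrix_power A n $ i $ j > 0)"

definition markov_chain :: "real ^ 'a ^ 'a \<Rightarrow> (nat \<Rightarrow> 'a) set" where
  "markov_chain A = {\<omega>. \<forall>m. A $ \<omega> m $ \<omega> (Suc m) = 1}"

definition cylinder :: "(nat \<Rightarrow> 'a) set \<Rightarrow> 'a list \<Rightarrow> (nat \<Rightarrow> 'a) set" where
  "cylinder \<Sigma> u = {\<omega> \<in> \<Sigma>. map \<omega> [0..<length u] = u}"

text \<open>The length of the maximal common prefix; meaningful for distinct sequences only.\<close>

definition common_prefix_length :: "(nat \<Rightarrow> 'a) \<Rightarrow> (nat \<Rightarrow> 'a) \<Rightarrow> nat" where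
  "common_prefix_length \<omega> \<tau> = (LEAST n. \<omega> n \<noteq> \<tau> n)"

definition proj_diff :: "(real \<Rightarrow> (nat \<Rightarrow> 'a) \<Rightarrow> real) \<Rightarrow> (nat \<Rightarrow> 'a) \<Rightarrow> (nat \<Rightarrow> 'a) \<Rightarrow> real \<Rightarrow> real" where
  "proj_diff P \<omega> \<tau> l = P l \<omega> - P l \<tau>"

definition Cantor_set :: "real set \<Rightarrow> bool" where
  "Cantor_set S \<longleftrightarrow> S homeomorphic (UNIV :: (nat \<Rightarrow> bool) set)"

definition compactly_supported :: "real measure \<Rightarrow> bool" where
  "compactly_supported \<eta> \<longleftrightarrow> (\<exists>K. compact K \<and> emeasure \<eta> (- K) = 0)"

text \<open>
  The convention \<^prop>\<open>ln (0::real) = 0\<close> plays no role here: almost every point lies in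
  the support of the measure, where all the intervals have positive measure.
\<close>

definition exact_local_dimension :: "real measure \<Rightarrow> real \<Rightarrow> bool" where
  "exact_local_dimension \<eta> d \<longleftrightarrow>
     (AE x in \<eta>. ((\<lambda>r. ln (measure \<eta> {x - r..x + r}) / ln r) \<longlongrightarrow> d) (at_right 0))"

end

theory Submission
  imports Defs
begin

text \<open>
  The proof is a transversality argument. Write \<open>\<ell>\<close> for the size of the alphabet and
  \<open>\<Pi>\<^sub>\<lambda>\<close> for the projections. It suffices to treat the image \<open>m\<^sub>\<lambda>\<close>, under
  \<open>(x, \<omega>) \<mapsto> x + \<Pi>\<^sub>\<lambda>(\<omega>)\<close>, of \<open>\<eta> \<times> \<mu>\<close> restricted to a
  rectangle \<open>G \<times> W\<close>, because countably many rectangles carry the whole mass. Here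
  \<open>G\<close> is a set on which the balls of \<open>\<eta>\<close> satisfy a uniform bound \<open>O(r\<^sup>s)\<close>, with
  \<open>s\<close> slightly below the local dimension, and \<open>W\<close> is the part of a good set
  \<open>\<Omega>\<close> that lies in a single cylinder of length \<open>k\<^sub>0\<close>.

  A finite measure \<open>m\<close> on the line is absolutely continuous as soon as its energy
  \<open>(m \<times> m){|u - v| \<le> r}\<close> is \<open>O(r)\<close> along some scales \<open>r\<close> tending to 0
  (\<open>small_energy_imp_absolutely_continuous\<close>). By Fatou and Fubini this happens for
  \<open>m\<^sub>\<lambda>\<close> and almost every \<open>\<lambda>\<close> once the energy, averaged over
  \<open>\<lambda>\<close>, is \<open>O(r)\<close> (\<open>AE_absolutely_continuous_distr\<close>). So the
  task is to show, for fixed \<open>(x, \<omega>)\<close>, that the integral over \<open>(y, \<tau>)\<close> of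
  the length of \<open>{\<lambda>. |x + \<Pi>\<^sub>\<lambda>(\<omega>) - y - \<Pi>\<^sub>\<lambda>(\<tau>)| \<le> r}\<close> is
  \<open>O(r)\<close> (\<open>fibre_energy_bound\<close>).

  Sort the \<open>\<tau>\<close> by \<open>n = |\<omega> \<and> \<tau>|\<close>. Those of level \<open>n\<close> have mass
  \<open>O(\<ell>\<^bsup>-\<gamma>n\<^esup>)\<close>; the length in question is at most
  \<open>min (C\<^sub>2 \<ell>\<^bsup>\<beta>n\<^esup> r) |J|\<close>, and vanishes unless
  \<open>|x - y| \<le> r + C\<^sub>1 \<ell>\<^bsup>-\<alpha>n\<^esup>\<close>, a set of \<open>y\<close> of mass
  \<open>O(r\<^sup>s + \<ell>\<^bsup>-\<alpha>ns\<^esup>)\<close>. The second summand contributes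
  \<open>r \<Sum> \<ell>\<^bsup>(\<beta> - \<alpha>s - \<gamma>)n\<^esup>\<close>, which converges when
  \<open>s > (\<beta> - \<gamma>)/\<alpha>\<close>. In the first, interpolating
  \<open>min a b \<le> a\<^bsup>\<theta>\<^esup> b\<^bsup>1-\<theta>\<^esup>\<close> with \<open>s + \<theta> \<ge> 1\<close>
  leaves \<open>r \<Sum> \<ell>\<^bsup>(\<beta>\<theta> - \<gamma>)n\<^esup>\<close>, which converges when
  \<open>\<theta> < \<gamma>/\<beta>\<close>. Both requirements can be met, with \<open>s < d\<close> or \<open>s = d = 0\<close>, because
  \<open>d > (\<beta> - \<gamma>)/\<alpha>\<close> and \<open>d + \<gamma>/\<beta> > 1\<close>
  (\<open>exponents_exist\<close>).

  Fubini needs joint measurability, although the single functions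
  \<open>\<lambda> \<mapsto> \<Pi>\<^sub>\<lambda>(\<omega>)\<close> may fail to be measurable. Only differences
  \<open>\<Pi>\<^sub>\<lambda>(\<omega>) - \<Pi>\<^sub>\<lambda>(\<tau>)\<close> enter the energy, and only those with
  a common prefix of length at least \<open>k\<^sub>0\<close> are known to be measurable in \<open>\<lambda>\<close>;
  this is why \<open>\<Omega>\<close> is cut into cylinders
  (\<open>measurable_differences_from_prefixes\<close>).
\<close>

section \<open>Absolute continuity from small energy\<close>

text \<open>
  Let \<open>K\<close> be a compact null set and \<open>U\<close> a small open set containing the
  \<open>\<rho>\<close>-neighbourhood of \<open>K\<close>, with \<open>\<rho> = r/2\<close>. Then \<open>r m(K)\<close> is at most the
  integral over \<open>U\<close> of \<open>g(t) = m([t - \<rho>, t + \<rho>])\<close>. By Cauchy-Schwarz its square is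
  at most \<open>|U|\<close> times the integral of \<open>g\<^sup>2\<close>, and the latter is at most \<open>r\<close> times
  the energy at scale \<open>r\<close>. Hence \<open>m(K)\<^sup>2 \<le> C |U|\<close>, and \<open>|U|\<close> is arbitrarily
  small. Inner regularity extends this to all null sets.
\<close>

lemma small_energy_imp_absolutely_continuous:
  fixes m :: "real measure" and C :: ennreal
  assumes "finite_measure m" and sets_m [measurable_cong]: "sets m = sets borel" and "C < \<infinity>"
    and energy: "\<And>\<delta>::real. \<delta> > 0 \<Longrightarrow>
      \<exists>r. 0 < r \<and> r < \<delta> \<and> emeasure (m \<Otimes>\<^sub>M m) {p. \<bar>fst p - snd p\<bar> \<le> r} \<le> C * ennreal r"
  shows "absolutely_continuous lborel m"
proof -
  interpret finite_measure m by fact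
  interpret lm: pair_sigma_finite m lborel ..
  interpret mmf: finite_measure "m \<Otimes>\<^sub>M m" by (intro finite_measure_pair_measure) fact+
  interpret lmm: pair_sigma_finite "m \<Otimes>\<^sub>M m" lborel ..
  have space_m: "space m = UNIV" using sets_eq_imp_space_eq[OF sets_m] by simp
  have D: "{p. \<bar>fst p - snd p\<bar> \<le> r} \<in> sets (m \<Otimes>\<^sub>M m)" for r :: real
  proof -
    have "{p \<in> space (m \<Otimes>\<^sub>M m). \<bar>fst p - snd p\<bar> \<le> r} \<in> sets (m \<Otimes>\<^sub>M m)"
      by measurable
    then show ?thesis by (simp add: space_pair_measure space_m)
  qed
  have compact_null: "emeasure m K = 0" if K: "compact K" "K \<in> null_sets lborel" for K
  proof -
    have square: "(emeasure m K)\<^sup>2 \<le> C * ennreal e" if "e > 0" for e :: real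
    proof -
      have [measurable]: "K \<in> sets borel" using K by auto
      have "K \<in> sets lebesgue" by simp
      then obtain U where U: "open U" "K \<subseteq> U" "emeasure lebesgue (U - K) < ennreal e"
        using sets_lebesgue_outer_open \<open>e > 0\<close> by metis
      have [measurable]: "U \<in> sets borel" using U by auto
      have "emeasure lborel U \<le> emeasure lborel (U - K) + emeasure lborel K"
        by (rule order_trans[OF _ emeasure_subadditive]) (auto intro!: emeasure_mono)
      then have Ue: "emeasure lborel U \<le> ennreal e" using U(3) K(2) by (simp add: null_setsD1)
      obtain \<delta> where \<delta>: "\<delta> > 0" "(\<Union>x\<in>K. ball x \<delta>) \<subseteq> U"
        using compact_subset_open_imp_ball_epsilon_subset[OF K(1) U(1,2)] by metis
      obtain r where r: "0 < r" "r < \<delta>"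
        and E: "emeasure (m \<Otimes>\<^sub>M m) {p. \<bar>fst p - snd p\<bar> \<le> r} \<le> C * ennreal r"
        using energy[OF \<delta>(1)] by auto
      define \<rho> where "\<rho> = r / 2"
      have \<rho>: "\<rho> > 0" "r = 2 * \<rho>" using r by (auto simp: \<rho>_def)
      define T :: "real \<Rightarrow> real \<Rightarrow> ennreal" where "T y t = indicator {- \<rho>..\<rho>} (y - t)" for y t
      have T_measurable [measurable]: "case_prod T \<in> borel_measurable (borel \<Otimes>\<^sub>M borel)"
        unfolding T_def by measurable
      define g where "g t = (\<integral>\<^sup>+y. T y t \<partial>m)" for t
      have g_measurable [measurable]: "g \<in> borel_measurable borel" unfolding g_def by measurable
      have len: "(\<integral>\<^sup>+t. T y t \<partial>lborel) = ennreal r" for y :: real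
      proof -
        have "(\<integral>\<^sup>+t. T y t \<partial>lborel)
            = (\<integral>\<^sup>+t. indicator {y - \<rho> .. y + \<rho>} t \<partial>lborel)"
          by (intro nn_integral_cong) (auto simp: T_def split: split_indicator)
        also have "\<dots> = ennreal r" using \<rho> by simp
        finally show ?thesis .
      qed
      have "emeasure m K * ennreal r
          = (\<integral>\<^sup>+y. \<integral>\<^sup>+t. indicator K y * T y t \<partial>lborel \<partial>m)"
        by (simp add: nn_integral_cmult len nn_integral_multc)
      also have "\<dots> \<le> (\<integral>\<^sup>+y. \<integral>\<^sup>+t. indicator U t * T y t \<partial>lborel \<partial>m)"
      proof (intro nn_integral_mono)
        fix y t :: real
        have "t \<in> U" if "y \<in> K" "- \<rho> \<le> y - t" "y - t \<le> \<rho>"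
        proof -
          have "t \<in> ball y \<delta>" using that r \<rho> by (simp add: dist_real_def abs_if)
          then show ?thesis using \<delta>(2) that(1) by blast
        qed
        then show "indicator K y * T y t \<le> indicator U t * T y t"
          by (auto simp: T_def split: split_indicator)
      qed
      also have "\<dots> = (\<integral>\<^sup>+t. \<integral>\<^sup>+y. indicator U t * T y t \<partial>m \<partial>lborel)"
        by (rule lm.Fubini'[symmetric]) measurable
      also have "\<dots> = (\<integral>\<^sup>+t. indicator U t * g t \<partial>lborel)"
        unfolding g_def by (intro nn_integral_cong nn_integral_cmult) measurable
      finally have first: "emeasure m K * ennreal r \<le> (\<integral>\<^sup>+t. indicator U t * g t \<partial>lborel)" .
      \<comment> \<open>Two points within \<open>\<rho>\<close> of a common \<open>t\<close> are within \<open>r\<close> of each other.\<close>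
      have "(\<integral>\<^sup>+t. (g t)\<^sup>2 \<partial>lborel) = (\<integral>\<^sup>+t. \<integral>\<^sup>+p. T (fst p) t
                    * T (snd p) t \<partial>(m \<Otimes>\<^sub>M m) \<partial>lborel)"
        by (subst nn_integral_fst[symmetric])
           (auto simp: g_def power2_eq_square nn_integral_cmult nn_integral_multc)
      also have "\<dots> = (\<integral>\<^sup>+p. \<integral>\<^sup>+t. T (fst p) t
                    * T (snd p) t \<partial>lborel \<partial>(m \<Otimes>\<^sub>M m))"
        by (rule lmm.Fubini') measurable
      also have "\<dots> \<le> (\<integral>\<^sup>+p. \<integral>\<^sup>+t. indicator {p. \<bar>fst p - snd p\<bar> \<le> r} p
                    * T (fst p) t \<partial>lborel \<partial>(m \<Otimes>\<^sub>M m))"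
        using \<rho> by (intro nn_integral_mono) (auto simp: T_def split: split_indicator)
      also have "\<dots> = emeasure (m \<Otimes>\<^sub>M m) {p. \<bar>fst p - snd p\<bar> \<le> r} * ennreal r"
        by (simp add: nn_integral_cmult len nn_integral_multc D)
      finally have second: "(\<integral>\<^sup>+t. (g t)\<^sup>2 \<partial>lborel) \<le> C * ennreal r * ennreal r"
        using E by (meson mult_right_mono order_trans zero_le)
      have "(emeasure m K * ennreal r)\<^sup>2 \<le> (\<integral>\<^sup>+t. indicator U t * g t \<partial>lborel)\<^sup>2"
        using first by (intro power_mono) auto
      also have "\<dots> \<le> (\<integral>\<^sup>+t. (indicator U t)\<^sup>2 \<partial>lborel) * (\<integral>\<^sup>+t. (g t)\<^sup>2 \<partial>lborel)"
        by (rule Cauchy_Schwarz_nn_integral) measurable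
      also have "(\<integral>\<^sup>+t. (indicator U t)\<^sup>2 \<partial>lborel) = emeasure lborel U"
      proof -
        have "(\<integral>\<^sup>+t. (indicator U t)\<^sup>2 \<partial>lborel) = (\<integral>\<^sup>+t. indicator U t \<partial>lborel)"
          by (intro nn_integral_cong) (auto split: split_indicator)
        then show ?thesis by simp
      qed
      also have "emeasure lborel U * (\<integral>\<^sup>+t. (g t)\<^sup>2 \<partial>lborel) \<le> ennreal e * (C * ennreal r * ennreal r)"
        using Ue second by (intro mult_mono) auto
      finally have "(emeasure m K)\<^sup>2 * (ennreal r)\<^sup>2 \<le> (C * ennreal e) * (ennreal r)\<^sup>2"
        by (simp add: power2_eq_square ac_simps)
      then show ?thesis
        using r ennreal_mult_le_mult_iff[of "(ennreal r)\<^sup>2" "(emeasure m K)\<^sup>2" "C * ennreal e"]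
        by (simp add: mult.commute[of "ennreal (r\<^sup>2)"] ennreal_power)
    qed
    have "(emeasure m K)\<^sup>2 \<le> 0"
    proof (rule ennreal_le_epsilon)
      fix e :: real assume "e > 0"
      obtain c where c: "C = ennreal c" "c \<ge> 0" using \<open>C < \<infinity>\<close> by (cases C) auto
      have "(emeasure m K)\<^sup>2 \<le> C * ennreal (e / (c + 1))" using c \<open>e > 0\<close> by (intro square) auto
      also have "\<dots> \<le> ennreal e" using c \<open>e > 0\<close>
        by (auto simp: ennreal_mult[symmetric] field_simps intro!: ennreal_leI)
      finally show "(emeasure m K)\<^sup>2 \<le> 0 + ennreal e" by simp
    qed
    then show ?thesis by simp
  qed
  show ?thesis unfolding absolutely_continuous_def
  proof
    fix N :: "real set" assume N: "N \<in> null_sets lborel"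
    then have [measurable]: "N \<in> sets borel" by auto
    have "emeasure m N = (SUP K\<in>{K. K \<subseteq> N \<and> compact K}. emeasure m K)"
      by (rule inner_regular) (auto simp: sets_m)
    also have "\<dots> \<le> 0"
    proof (intro SUP_least)
      fix K assume "K \<in> {K. K \<subseteq> N \<and> compact K}"
      then have "compact K" "K \<in> null_sets lborel"
        by (auto intro!: null_sets_subset[OF N] simp: compact_imp_closed)
      then show "emeasure m K \<le> 0" by (simp add: compact_null)
    qed
    finally show "N \<in> null_sets m" by (auto simp: sets_m)
  qed
qed

text \<open>
  The energies at the scales \<open>2\<^sup>-\<^sup>k\<close>, divided by \<open>2\<^sup>-\<^sup>k\<close>, have bounded
  integrals over the parameter. By Fatou their lower limit is finite for almost every parameter, which is
  what the preceding criterion needs. Measurability in the parameter is asked only of the differences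
  \<open>f l p - f l q\<close>: the map \<open>l \<mapsto> f l p\<close> may be non-measurable.
\<close>

lemma AE_absolutely_continuous_distr:
  fixes f :: "'l \<Rightarrow> 'p \<Rightarrow> real"
  assumes "sigma_finite_measure \<Lambda>" "finite_measure M"
    and meas: "\<And>l. l \<in> space \<Lambda> \<Longrightarrow> f l \<in> borel_measurable M"
    and joint [measurable]:
      "(\<lambda>z. f (fst z) (fst (snd z)) - f (fst z) (snd (snd z))) \<in> borel_measurable (\<Lambda> \<Otimes>\<^sub>M (M \<Otimes>\<^sub>M M))"
    and "C \<ge> 0"
    and energy: "\<And>r p. 0 < r \<Longrightarrow> r \<le> 1 \<Longrightarrow> p \<in> space M \<Longrightarrow>
      (\<integral>\<^sup>+q. emeasure \<Lambda> {l \<in> space \<Lambda>. \<bar>f l p - f l q\<bar> \<le> r} \<partial>M) \<le> ennreal (C * r)"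
  shows "AE l in \<Lambda>. absolutely_continuous lborel (distr M borel (f l))"
proof -
  interpret L: sigma_finite_measure \<Lambda> by fact
  interpret finite_measure M by fact
  interpret MM: finite_measure "M \<Otimes>\<^sub>M M" by (intro finite_measure_pair_measure) fact+
  interpret lmm: pair_sigma_finite \<Lambda> "M \<Otimes>\<^sub>M M" ..
  define T :: "real \<Rightarrow> 'l \<Rightarrow> 'p \<times> 'p \<Rightarrow> ennreal"
    where "T r l z = indicator {- r..r} (f l (fst z) - f l (snd z))" for r l z
  have T_measurable [measurable]: "case_prod (T r) \<in> borel_measurable (\<Lambda> \<Otimes>\<^sub>M (M \<Otimes>\<^sub>M M))" for r
    unfolding T_def case_prod_beta by measurable
  define E where "E k l = (\<integral>\<^sup>+z. T ((1/2) ^ k) l z \<partial>(M \<Otimes>\<^sub>M M)) * ennreal (2 ^ k)" for k :: nat and l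
  have E_measurable [measurable]: "E k \<in> borel_measurable \<Lambda>" for k
    unfolding E_def by measurable
  have E_le: "(\<integral>\<^sup>+l. E k l \<partial>\<Lambda>) \<le> ennreal C * emeasure M (space M)" for k
  proof -
    have slice: "(\<integral>\<^sup>+l. T ((1/2) ^ k) l z \<partial>\<Lambda>)
        = emeasure \<Lambda> {l \<in> space \<Lambda>. \<bar>f l (fst z) - f l (snd z)\<bar> \<le> (1/2) ^ k}"
      if "z \<in> space (M \<Otimes>\<^sub>M M)" for z
    proof -
      have [measurable]: "(\<lambda>l. f l (fst z) - f l (snd z)) \<in> borel_measurable \<Lambda>"
        using measurable_compose[OF measurable_Pair2'[OF that] joint] by simp
      have "(\<integral>\<^sup>+l. T ((1/2) ^ k) l z \<partial>\<Lambda>)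
          = (\<integral>\<^sup>+l. indicator {l \<in> space \<Lambda>. \<bar>f l (fst z) - f l (snd z)\<bar> \<le> (1/2) ^ k} l \<partial>\<Lambda>)"
        by (intro nn_integral_cong) (auto simp: T_def abs_le_iff split: split_indicator)
      also have "\<dots> = emeasure \<Lambda> {l \<in> space \<Lambda>. \<bar>f l (fst z) - f l (snd z)\<bar> \<le> (1/2) ^ k}"
        by (intro nn_integral_indicator) measurable
      finally show ?thesis .
    qed
    have "(\<integral>\<^sup>+l. E k l \<partial>\<Lambda>) = (\<integral>\<^sup>+l. \<integral>\<^sup>+z. T ((1/2) ^ k) l z \<partial>(M \<Otimes>\<^sub>M M) \<partial>\<Lambda>) * ennreal (2 ^ k)"
      unfolding E_def by (intro nn_integral_multc) measurable
    also have "(\<integral>\<^sup>+l. \<integral>\<^sup>+z. T ((1/2) ^ k) l z \<partial>(M \<Otimes>\<^sub>M M) \<partial>\<Lambda>)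
        = (\<integral>\<^sup>+z. \<integral>\<^sup>+l. T ((1/2) ^ k) l z \<partial>\<Lambda> \<partial>(M \<Otimes>\<^sub>M M))"
      by (rule lmm.Fubini'[symmetric]) measurable
    also have "\<dots> = (\<integral>\<^sup>+p. \<integral>\<^sup>+q. \<integral>\<^sup>+l. T ((1/2) ^ k) l (p, q) \<partial>\<Lambda> \<partial>M \<partial>M)"
      by (rule nn_integral_fst[symmetric]) measurable
    also have "\<dots> \<le> (\<integral>\<^sup>+p. ennreal (C * (1/2) ^ k) \<partial>M)"
    proof (rule nn_integral_mono)
      fix p assume p: "p \<in> space M"
      have "(\<integral>\<^sup>+q. \<integral>\<^sup>+l. T ((1/2) ^ k) l (p, q) \<partial>\<Lambda> \<partial>M)
          = (\<integral>\<^sup>+q. emeasure \<Lambda> {l \<in> space \<Lambda>. \<bar>f l p - f l q\<bar> \<le> (1/2) ^ k} \<partial>M)"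
        using p by (intro nn_integral_cong) (simp add: slice space_pair_measure)
      also have "\<dots> \<le> ennreal (C * (1/2) ^ k)" using p by (intro energy) (auto simp: power_le_one)
      finally show "(\<integral>\<^sup>+q. \<integral>\<^sup>+l. T ((1/2) ^ k) l (p, q) \<partial>\<Lambda> \<partial>M) \<le> ennreal (C * (1/2) ^ k)" .
    qed
    also have "\<dots> * ennreal (2 ^ k) = ennreal (C * (1/2) ^ k) * ennreal (2 ^ k) * emeasure M (space M)"
      by (simp add: ac_simps)
    also have "ennreal (C * (1/2) ^ k) * ennreal (2 ^ k) = ennreal C"
      using \<open>C \<ge> 0\<close> by (simp add: ennreal_mult[symmetric] mult.assoc power_mult_distrib[symmetric])
    finally show ?thesis by (simp add: mult_right_mono)
  qed
  have "(\<integral>\<^sup>+l. liminf (\<lambda>k. E k l) \<partial>\<Lambda>) \<le> liminf (\<lambda>k. \<integral>\<^sup>+l. E k l \<partial>\<Lambda>)"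
    by (intro nn_integral_liminf) measurable
  also have "\<dots> \<le> ennreal C * emeasure M (space M)"
    by (intro Liminf_le) (simp_all add: E_le)
  finally have "(\<integral>\<^sup>+l. liminf (\<lambda>k. E k l) \<partial>\<Lambda>) \<noteq> \<infinity>"
    by (auto simp: top_unique emeasure_eq_measure ennreal_mult[symmetric] \<open>C \<ge> 0\<close>)
  then have "AE l in \<Lambda>. liminf (\<lambda>k. E k l) \<noteq> \<infinity>"
    by (intro nn_integral_noteq_infinite) measurable
  then show ?thesis
  proof (rule AE_mp[OF _ AE_I2], intro impI)
    fix l assume l: "l \<in> space \<Lambda>" and "liminf (\<lambda>k. E k l) \<noteq> \<infinity>"
    then obtain c where c: "liminf (\<lambda>k. E k l) < c" "c < \<infinity>"
      using dense[of "liminf (\<lambda>k. E k l)" top] by (auto simp: less_top)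
    have [measurable]: "f l \<in> borel_measurable M" using meas l .
    interpret d: finite_measure "distr M borel (f l)" by (rule finite_measure_distr) measurable
    show "absolutely_continuous lborel (distr M borel (f l))"
    proof (rule small_energy_imp_absolutely_continuous)
      show "c < \<infinity>" by fact
      show "finite_measure (distr M borel (f l))" by (rule d.finite_measure_axioms)
      fix \<delta> :: real assume "\<delta> > 0"
      have "\<not> (\<forall>\<^sub>F k in sequentially. c \<le> E k l)"
        using Liminf_bounded[of c "\<lambda>k. E k l" sequentially] c(1) by auto
      moreover have "\<forall>\<^sub>F k in sequentially. (1/2::real) ^ k < \<delta>"
        using \<open>\<delta> > 0\<close> by (intro order_tendstoD(2)[OF LIMSEQ_power_zero]) auto
      ultimately have "\<exists>k. (1/2::real) ^ k < \<delta> \<and> \<not> c \<le> E k l"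
        by (metis (mono_tags, lifting) eventually_mono)
      then obtain k where k: "(1/2::real) ^ k < \<delta>" "E k l < c" by auto
      let ?r = "(1/2::real) ^ k"
      have D: "{p. \<bar>fst p - snd p\<bar> \<le> ?r} \<in> sets (borel \<Otimes>\<^sub>M borel)"
      proof -
        have "{p \<in> space (borel \<Otimes>\<^sub>M borel). \<bar>fst p - snd p :: real\<bar> \<le> ?r} \<in> sets (borel \<Otimes>\<^sub>M borel)"
          by measurable
        then show ?thesis by (simp add: space_pair_measure)
      qed
      have "distr M borel (f l) \<Otimes>\<^sub>M distr M borel (f l)
          = distr (M \<Otimes>\<^sub>M M) (borel \<Otimes>\<^sub>M borel) (\<lambda>(x, y). (f l x, f l y))"
        by (intro pair_measure_distr) (auto intro: d.sigma_finite_measure_axioms)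
      then have "emeasure (distr M borel (f l) \<Otimes>\<^sub>M distr M borel (f l)) {p. \<bar>fst p - snd p\<bar> \<le> ?r}
          = (\<integral>\<^sup>+z. indicator {p. \<bar>fst p - snd p\<bar> \<le> ?r} ((\<lambda>(x, y). (f l x, f l y)) z) \<partial>(M \<Otimes>\<^sub>M M))"
        using D by (simp add: nn_integral_indicator[symmetric] nn_integral_distr del: nn_integral_indicator)
      also have "\<dots> = (\<integral>\<^sup>+z. T ?r l z \<partial>(M \<Otimes>\<^sub>M M))"
        by (intro nn_integral_cong) (auto simp: T_def abs_le_iff split: split_indicator)
      also have "\<dots> = E k l * ennreal ?r"
        by (simp add: E_def mult.assoc ennreal_mult[symmetric] power_mult_distrib[symmetric])
      also have "\<dots> \<le> c * ennreal ?r" using k by (intro mult_right_mono) auto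
      finally show "\<exists>r. 0 < r \<and> r < \<delta> \<and>
          emeasure (distr M borel (f l) \<Otimes>\<^sub>M distr M borel (f l)) {p. \<bar>fst p - snd p\<bar> \<le> r} \<le> c * ennreal r"
        using k by (intro exI[of _ ?r]) auto
    qed simp
  qed
qed

section \<open>Uniform ball bounds from the local dimension\<close>

lemma exact_local_dimension_nonneg:
  assumes "prob_space \<eta>" and "exact_local_dimension \<eta> d"
  shows "d \<ge> 0"
proof -
  interpret prob_space \<eta> by fact
  have "\<exists>x. ((\<lambda>r. ln (measure \<eta> {x - r..x + r}) / ln r) \<longlongrightarrow> d) (at_right 0)"
  proof (rule ccontr)
    assume "\<not> ?thesis"
    then have "AE x in \<eta>. False" using assms(2) by (simp add: exact_local_dimension_def)
    then show False by simp
  qed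
  then obtain x where "((\<lambda>r. ln (measure \<eta> {x - r..x + r}) / ln r) \<longlongrightarrow> d) (at_right 0)" ..
  then show ?thesis
  proof (rule tendsto_lowerbound)
    have "0 \<le> ln (measure \<eta> {x - r..x + r}) / ln r" if "0 < r" "r < 1" for r
    proof -
      have "ln (measure \<eta> {x - r..x + r}) \<le> 0"
        using prob_le_1 by (cases "measure \<eta> {x - r..x + r} = 0") (auto simp: zero_less_measure_iff)
      then show ?thesis using that by (intro divide_nonpos_neg) auto
    qed
    then show "\<forall>\<^sub>F r in at_right 0. 0 \<le> ln (measure \<eta> {x - r..x + r}) / ln r"
      by (auto simp: eventually_at_right_field intro!: exI[of _ 1])
  qed simp
qed

text \<open>
  For \<open>s < d\<close> the ratio \<open>ln \<eta>(B(x, r)) / ln r\<close> exceeds \<open>s\<close> for small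
  \<open>r\<close>, at almost every \<open>x\<close>. So \<open>\<eta>(B(x, r)) / r\<^sup>s\<close> is bounded in
  \<open>r\<close>, and \<open>G m\<close> collects the points where \<open>m\<close> is a bound. The exponent
  \<open>s = 0\<close> is admitted for the sake of measures of dimension 0.
\<close>

lemma exact_local_dimension_uniform_balls:
  assumes "prob_space \<eta>" and sets_\<eta> [measurable_cong]: "sets \<eta> = sets borel"
    and "exact_local_dimension \<eta> d" and s: "s \<ge> 0" "s = 0 \<or> s < d"
  obtains G :: "nat \<Rightarrow> real set" where "\<And>m. G m \<in> sets borel"
    and "\<And>m x r. x \<in> G m \<Longrightarrow> r > 0 \<Longrightarrow> measure \<eta> {x - r..x + r} \<le> real m * (2 * r) powr s"
    and "AE x in \<eta>. \<exists>m. x \<in> G m"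
proof -
  interpret prob_space \<eta> by fact
  \<comment> \<open>Rational radii make \<open>G m\<close> measurable; the factor 2 in the statement pays for this restriction.\<close>
  define G where "G m = {x. \<forall>q\<in>\<rat>. q > 0 \<longrightarrow> measure \<eta> {x - q..x + q} \<le> real m * q powr s}" for m :: nat
  have [measurable]: "(\<lambda>x. measure \<eta> {x - q..x + q}) \<in> borel_measurable borel" for q
  proof -
    have "(\<lambda>x. enn2real (\<integral>\<^sup>+y. indicator {- q..q} (y - x) \<partial>\<eta>)) \<in> borel_measurable borel"
      by measurable
    also have "(\<lambda>x. enn2real (\<integral>\<^sup>+y. indicator {- q..q} (y - x) \<partial>\<eta>)) = (\<lambda>x. measure \<eta> {x - q..x + q})"
    proof
      fix x
      have "(\<integral>\<^sup>+y. indicator {- q..q} (y - x) \<partial>\<eta>) = (\<integral>\<^sup>+y. indicator {x - q..x + q} y \<partial>\<eta>)"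
        by (intro nn_integral_cong) (auto split: split_indicator)
      also have "\<dots> = emeasure \<eta> {x - q..x + q}" by (simp add: sets_\<eta>)
      finally show "enn2real (\<integral>\<^sup>+y. indicator {- q..q} (y - x) \<partial>\<eta>) = measure \<eta> {x - q..x + q}"
        by (simp add: measure_def)
    qed
    finally show ?thesis .
  qed
  have 1: "G m \<in> sets borel" for m
  proof -
    have "G m = (\<Inter>q\<in>{q\<in>\<rat>. q > 0}. {x \<in> space borel. measure \<eta> {x - q..x + q} \<le> real m * q powr s})"
      by (auto simp: G_def)
    also have "\<dots> \<in> sets borel"
    proof (rule sets.countable_INT'')
      show "countable {q\<in>\<rat>. q > (0::real)}"
        by (rule countable_subset[OF _ countable_rat]) auto
      show "{x \<in> space borel. measure \<eta> {x - q..x + q} \<le> real m * q powr s} \<in> sets borel" for q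
        by measurable
    qed simp
    finally show ?thesis .
  qed
  have 2: "measure \<eta> {x - r..x + r} \<le> real m * (2 * r) powr s" if x: "x \<in> G m" and "r > 0" for m x r
  proof -
    obtain q where q: "q \<in> \<rat>" "r < q" "q < 2 * r"
      using Rats_dense_in_real[of r "2 * r"] \<open>r > 0\<close> by auto
    have "measure \<eta> {x - r..x + r} \<le> measure \<eta> {x - q..x + q}"
      using q by (intro finite_measure_mono) (auto simp: sets_\<eta>)
    also have "\<dots> \<le> real m * q powr s" using x q \<open>r > 0\<close> by (auto simp: G_def)
    also have "\<dots> \<le> real m * (2 * r) powr s"
      using q \<open>r > 0\<close> s by (intro mult_left_mono powr_mono2) auto
    finally show ?thesis .
  qed
  have 3: "AE x in \<eta>. \<exists>m. x \<in> G m"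
    using assms(3) unfolding exact_local_dimension_def
  proof eventually_elim
    fix x assume lim: "((\<lambda>r. ln (measure \<eta> {x - r..x + r}) / ln r) \<longlongrightarrow> d) (at_right 0)"
    have "\<exists>r0>0. \<forall>r. 0 < r \<and> r < r0 \<longrightarrow> measure \<eta> {x - r..x + r} \<le> r powr s"
    proof (cases "s = 0")
      case True
      then show ?thesis using prob_le_1 by (intro exI[of _ 1]) auto
    next
      case False
      then have "s < d" using s by auto
      then have "\<forall>\<^sub>F r in at_right 0. s < ln (measure \<eta> {x - r..x + r}) / ln r"
        using lim by (intro order_tendstoD)
      then obtain r1 where r1: "r1 > 0" "\<And>r. 0 < r \<Longrightarrow> r < r1 \<Longrightarrow> s < ln (measure \<eta> {x - r..x + r}) / ln r"
        by (auto simp: eventually_at_right_field)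
      have "measure \<eta> {x - r..x + r} \<le> r powr s" if "0 < r" "r < min r1 1" for r
      proof (cases "measure \<eta> {x - r..x + r} = 0")
        case False
        then have pos: "measure \<eta> {x - r..x + r} > 0" by (simp add: zero_less_measure_iff)
        have "ln r < 0" using that by simp
        then have "ln (measure \<eta> {x - r..x + r}) < s * ln r"
          using r1(2)[of r] that by (simp add: neg_less_divide_eq)
        then have "measure \<eta> {x - r..x + r} < exp (s * ln r)"
          using pos by (metis exp_less_mono exp_ln)
        then show ?thesis using that by (simp add: powr_def)
      qed simp
      then show ?thesis using r1(1) by (intro exI[of _ "min r1 1"]) auto
    qed
    then obtain r0 where r0: "r0 > 0" "\<And>r. 0 < r \<Longrightarrow> r < r0 \<Longrightarrow> measure \<eta> {x - r..x + r} \<le> r powr s"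
      by auto
    obtain m :: nat where m: "max 1 (1 / r0 powr s) \<le> real m" using real_arch_simple by blast
    have "measure \<eta> {x - q..x + q} \<le> real m * q powr s" if "q > 0" for q
    proof (cases "q < r0")
      case True
      have "measure \<eta> {x - q..x + q} \<le> 1 * q powr s" using r0 True that by simp
      also have "\<dots> \<le> real m * q powr s" using m by (intro mult_right_mono) auto
      finally show ?thesis .
    next
      case False
      have "measure \<eta> {x - q..x + q} \<le> (1 / r0 powr s) * r0 powr s" using r0 by simp
      also have "\<dots> \<le> real m * q powr s"
        using m False r0(1) s by (intro mult_mono powr_mono2) auto
      finally show ?thesis .
    qed
    then show "\<exists>m. x \<in> G m" by (auto simp: G_def)
  qed
  show thesis by (rule that[OF 1 2 3])
qed

section \<open>Joint measurability of differences of projections\<close>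

lemma sets_prefix_eq:
  fixes \<mu> :: "(nat \<Rightarrow> 'a :: {finite, discrete_topology}) measure"
  assumes "sets \<mu> = sets (restrict_space borel \<Sigma>)"
  shows "{\<omega> \<in> \<Sigma>. map \<omega> [0..<n] = u} \<in> sets \<mu>"
proof -
  have "open {\<omega> :: nat \<Rightarrow> 'a. \<omega> i = a}" for i a
  proof -
    have "open ((\<lambda>\<omega> :: nat \<Rightarrow> 'a. \<omega> i) -` {a})"
      by (intro open_vimage discrete_topology_class.open_discrete continuous_on_product_coordinates)
    also have "(\<lambda>\<omega> :: nat \<Rightarrow> 'a. \<omega> i) -` {a} = {\<omega>. \<omega> i = a}" by auto
    finally show ?thesis .
  qed
  then have "open (\<Inter>i<n. {\<omega> :: nat \<Rightarrow> 'a. \<omega> i = u ! i})" by (intro open_INT) auto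
  then have "open {\<omega> :: nat \<Rightarrow> 'a. \<forall>i<n. \<omega> i = u ! i}"
    by (rule back_subst[where P = "\<lambda>S. open S"]) auto
  moreover have "{\<omega> \<in> \<Sigma>. map \<omega> [0..<n] = u}
      = (if length u = n then \<Sigma> \<inter> {\<omega> :: nat \<Rightarrow> 'a. \<forall>i<n. \<omega> i = u ! i} else {})"
    by (auto simp: list_eq_iff_nth_eq)
  ultimately show ?thesis using assms by (auto simp: sets_restrict_space)
qed

lemma tendsto_of_common_prefixes:
  fixes \<omega> :: "nat \<Rightarrow> 'a :: topological_space"
  assumes "\<And>n i. i < n \<Longrightarrow> \<omega>' n i = \<omega> i"
  shows "\<omega>' \<longlonglongrightarrow> \<omega>"
proof -
  have "(\<lambda>n. \<omega>' n i) \<longlonglongrightarrow> \<omega> i" for i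
    by (rule tendsto_eventually) (use assms in \<open>auto intro: eventually_sequentiallyI[of "Suc i"]\<close>)
  then have "limitin (product_topology (\<lambda>_. euclidean) UNIV) \<omega>' \<omega> sequentially"
    by (simp add: limitin_componentwise)
  then show ?thesis by (simp add: euclidean_product_topology)
qed

text \<open>
  A function that is continuous in one variable and measurable in the other is jointly measurable. Replacing
  each sequence by a fixed representative in \<open>W\<close> with the same first \<open>n\<close> letters
  takes finitely many values, which gives measurable approximations; they converge by continuity of
  \<open>P l\<close>. The representatives are chosen in \<open>W\<close> since only there is measurability in
  \<open>l\<close> known.
\<close>

lemma measurable_differences_from_prefixes:
  fixes \<mu> :: "(nat \<Rightarrow> 'a :: {finite, discrete_topology}) measure"
    and P :: "'l \<Rightarrow> (nat \<Rightarrow> 'a) \<Rightarrow> real"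
  assumes sets_\<mu>: "sets \<mu> = sets (restrict_space borel \<Sigma>)" and W: "W \<in> sets \<mu>"
    and cont: "\<And>l. l \<in> space \<Lambda> \<Longrightarrow> continuous_on \<Sigma> (P l)"
    and meas: "\<And>\<omega> \<tau>. \<omega> \<in> W \<Longrightarrow> \<tau> \<in> W \<Longrightarrow> (\<lambda>l. P l \<omega> - P l \<tau>) \<in> borel_measurable \<Lambda>"
  shows "(\<lambda>z. P (fst z) (fst (snd z)) - P (fst z) (snd (snd z)))
    \<in> borel_measurable (\<Lambda> \<Otimes>\<^sub>M (restrict_space \<mu> W \<Otimes>\<^sub>M restrict_space \<mu> W))"
proof -
  let ?M = "restrict_space \<mu> W"
  have "space \<mu> = \<Sigma>" using sets_eq_imp_space_eq[OF sets_\<mu>] by (simp add: space_restrict_space)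
  then have W_sub: "W \<subseteq> \<Sigma>" using sets.sets_into_space[OF W] by simp
  then have space_M: "space ?M = W" using \<open>space \<mu> = \<Sigma>\<close> by (auto simp: space_restrict_space)
  define word :: "nat \<Rightarrow> (nat \<Rightarrow> 'a) \<Rightarrow> 'a list" where "word n \<omega> = map \<omega> [0..<n]" for n \<omega>
  define I where "I n = word n ` W" for n
  have finite_I: "finite (I n)" for n
    by (rule finite_subset[OF _ finite_lists_length_eq[of UNIV n]]) (auto simp: I_def word_def)
  have word_measurable: "word n \<in> measurable ?M (count_space (I n))" for n
  proof -
    have "word n -` {u} \<inter> W = {\<omega> \<in> \<Sigma>. map \<omega> [0..<n] = u} \<inter> W" for u
      using W_sub by (auto simp: word_def)
    moreover have "{\<omega> \<in> \<Sigma>. map \<omega> [0..<n] = u} \<inter> W \<in> sets ?M" for u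
      using sets_prefix_eq[OF sets_\<mu>] W by (auto simp: sets_restrict_space)
    ultimately show ?thesis
      by (subst measurable_count_space_eq2[OF finite_I]) (auto simp: space_M I_def)
  qed
  define rep where "rep n u = (SOME \<omega>. \<omega> \<in> W \<and> word n \<omega> = u)" for n u
  have rep: "rep n u \<in> W" "word n (rep n u) = u" if "u \<in> I n" for n u
    using someI_ex[of "\<lambda>\<omega>. \<omega> \<in> W \<and> word n \<omega> = u"] that unfolding rep_def I_def by auto
  show ?thesis
  proof (rule borel_measurable_LIMSEQ_real)
    fix n
    have "(\<lambda>z. (word n (fst (snd z)), word n (snd (snd z))))
        \<in> measurable (\<Lambda> \<Otimes>\<^sub>M (?M \<Otimes>\<^sub>M ?M)) (count_space (I n) \<Otimes>\<^sub>M count_space (I n))"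
      using word_measurable[of n] by measurable
    then have words: "(\<lambda>z. (word n (fst (snd z)), word n (snd (snd z))))
        \<in> measurable (\<Lambda> \<Otimes>\<^sub>M (?M \<Otimes>\<^sub>M ?M)) (count_space (I n \<times> I n))"
      by (simp add: pair_measure_countable countable_finite finite_I)
    have reps: "(\<lambda>z. P (fst z) (rep n (fst i)) - P (fst z) (rep n (snd i)))
        \<in> borel_measurable (\<Lambda> \<Otimes>\<^sub>M (?M \<Otimes>\<^sub>M ?M))" if "i \<in> I n \<times> I n" for i
      using that by (auto intro!: measurable_compose[OF measurable_fst meas] rep)
    have "countable (I n \<times> I n)" by (intro countable_finite finite_cartesian_product finite_I)
    from measurable_compose_countable'[where f = "\<lambda>i z. P (fst z) (rep n (fst i)) - P (fst z) (rep n (snd i))",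
        OF reps words this]
    show "(\<lambda>z. P (fst z) (rep n (word n (fst (snd z)))) - P (fst z) (rep n (word n (snd (snd z)))))
        \<in> borel_measurable (\<Lambda> \<Otimes>\<^sub>M (?M \<Otimes>\<^sub>M ?M))"
      by simp
  next
    fix z assume "z \<in> space (\<Lambda> \<Otimes>\<^sub>M (?M \<Otimes>\<^sub>M ?M))"
    then obtain l \<omega> \<tau> where z: "z = (l, \<omega>, \<tau>)" "l \<in> space \<Lambda>" "\<omega> \<in> W" "\<tau> \<in> W"
      by (auto simp: space_pair_measure space_M)
    have "(\<lambda>n. P l (rep n (word n \<sigma>))) \<longlonglongrightarrow> P l \<sigma>" if "\<sigma> \<in> W" for \<sigma>
    proof (rule continuous_on_tendsto_compose[OF cont[OF z(2)]])
      have R: "rep n (word n \<sigma>) \<in> W" "word n (rep n (word n \<sigma>)) = word n \<sigma>" for n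
        using rep[of "word n \<sigma>" n] that by (auto simp: I_def)
      show "(\<lambda>n. rep n (word n \<sigma>)) \<longlonglongrightarrow> \<sigma>"
        by (rule tendsto_of_common_prefixes) (use R(2) in \<open>auto simp: word_def\<close>)
      show "\<sigma> \<in> \<Sigma>" "\<forall>\<^sub>F n in sequentially. rep n (word n \<sigma>) \<in> \<Sigma>"
        using R(1) that W_sub by (auto intro!: always_eventually)
    qed
    then show "(\<lambda>n. P (fst z) (rep n (word n (fst (snd z)))) - P (fst z) (rep n (word n (snd (snd z)))))
        \<longlonglongrightarrow> P (fst z) (fst (snd z)) - P (fst z) (snd (snd z))"
      using z by (auto intro!: tendsto_diff)
  qed
qed

section \<open>The energy estimate\<close>

text \<open>
  Take \<open>s\<close> just below \<open>d\<close> and \<open>\<theta> = max 0 (1 - s)\<close>. If \<open>d = 0\<close>,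
  no \<open>s < d\<close> is nonnegative, but then \<open>\<gamma> > \<beta>\<close> and \<open>s = 0\<close>,
  \<open>\<theta> = 1\<close> serve.
\<close>

lemma exponents_exist:
  fixes d \<alpha> \<beta> \<gamma> :: real
  assumes "d \<ge> 0" "\<alpha> > 0" "\<beta> > 0" "\<gamma> > 0" "d + \<gamma> / \<beta> > 1" "d > (\<beta> - \<gamma>) / \<alpha>"
  obtains s \<theta> where "0 \<le> s" "s = 0 \<or> s < d" "0 \<le> \<theta>" "\<theta> \<le> 1" "1 \<le> s + \<theta>"
    "\<beta> * \<theta> < \<gamma>" "\<beta> - \<alpha> * s < \<gamma>"
proof (cases "d = 0")
  case True
  then have "\<beta> < \<gamma>" using assms by (simp add: field_simps)
  then show ?thesis using that[of 0 1] by simp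
next
  case False
  then have "max 0 (max (1 - \<gamma> / \<beta>) ((\<beta> - \<gamma>) / \<alpha>)) < d" using assms by auto
  then obtain s where s: "max 0 (max (1 - \<gamma> / \<beta>) ((\<beta> - \<gamma>) / \<alpha>)) < s" "s < d"
    using dense by blast
  then have "1 - s < \<gamma> / \<beta>" "(\<beta> - \<gamma>) / \<alpha> < s" by auto
  then have "\<beta> * (1 - s) < \<gamma>" "\<beta> - \<alpha> * s < \<gamma>" using assms by (simp_all add: field_simps)
  moreover have "0 \<le> s" "s < d" using s by auto
  ultimately show ?thesis
    using that[of s "max 0 (1 - s)"] assms by (cases "s \<le> 1") (simp_all add: max_def)
qed

lemma min_le_powr_interpolation:
  fixes a b \<theta> :: real
  assumes "a > 0" "b > 0" "0 \<le> \<theta>" "\<theta> \<le> 1"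
  shows "min a b \<le> a powr \<theta> * b powr (1 - \<theta>)"
proof -
  have "min a b = min a b powr \<theta> * min a b powr (1 - \<theta>)"
    using assms by (simp add: powr_add[symmetric])
  also have "\<dots> \<le> a powr \<theta> * b powr (1 - \<theta>)"
    using assms by (intro mult_mono powr_mono2) auto
  finally show ?thesis .
qed

text \<open>
  The contribution of one level \<open>t = |\<omega> \<and> \<tau>|\<close>: the length of the bad parameter
  set times the mass of the ball of admissible \<open>y\<close>. The ball radius is a sum, whose
  \<open>s\<close>-th power splits into \<open>r\<^sup>s\<close> and a power of \<open>L\<close>. The former is paired with
  the interpolated minimum, which supplies \<open>r\<^bsup>\<theta>\<^esup>\<close>, and the latter with the
  transversality bound, which is linear in \<open>r\<close>.
\<close>

lemma scale_contribution_le: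
  fixes C\<^sub>1 C\<^sub>2 V L r t s \<theta> \<alpha> \<beta> q :: real
  assumes pos: "C\<^sub>1 > 0" "C\<^sub>2 > 0" "V > 0" "L > 1" "0 < r" "r \<le> 1" "t \<ge> 0"
    and s: "0 \<le> s" "0 \<le> \<theta>" "\<theta> \<le> 1" "1 \<le> s + \<theta>"
    and q: "\<beta> * \<theta> \<le> q" "\<beta> - \<alpha> * s \<le> q"
  shows "min (C\<^sub>2 * L powr (t * \<beta>) * r) V * (2 * (r + C\<^sub>1 * L powr (- \<alpha> * t))) powr s
    \<le> 4 powr s * (C\<^sub>2 powr \<theta> * V powr (1 - \<theta>) + C\<^sub>2 * C\<^sub>1 powr s) * r * L powr (q * t)"
    (is "?b * ?p \<le> _")
proof -
  let ?l = "C\<^sub>1 * L powr (- \<alpha> * t)"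
  have l: "?l > 0" using pos by simp
  have b: "?b \<ge> 0" using pos by simp
  have "?p \<le> (4 * max r ?l) powr s"
    using pos l s by (intro powr_mono2) auto
  also have "\<dots> = 4 powr s * (max r ?l) powr s" using pos by (simp add: powr_mult max_def)
  also have "\<dots> \<le> 4 powr s * (r powr s + ?l powr s)"
    by (intro mult_left_mono) (auto simp: max_def)
  finally have "?b * ?p \<le> ?b * (4 powr s * (r powr s + ?l powr s))"
    using b by (intro mult_left_mono)
  also have "\<dots> = 4 powr s * (?b * r powr s + ?b * ?l powr s)" by (simp add: algebra_simps)
  also have "\<dots> \<le> 4 powr s * (C\<^sub>2 powr \<theta> * V powr (1 - \<theta>) * r * L powr (q * t) + C\<^sub>2 * C\<^sub>1 powr s * r * L powr (q * t))"
  proof (intro mult_left_mono add_mono)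
    have "?b * r powr s \<le> (C\<^sub>2 * L powr (t * \<beta>) * r) powr \<theta> * V powr (1 - \<theta>) * r powr s"
      using pos s by (intro mult_right_mono min_le_powr_interpolation) auto
    also have "\<dots> = C\<^sub>2 powr \<theta> * V powr (1 - \<theta>) * (r powr (s + \<theta>) * L powr (\<beta> * \<theta> * t))"
    proof -
      have "(C\<^sub>2 * L powr (t * \<beta>) * r) powr \<theta> = C\<^sub>2 powr \<theta> * L powr (t * \<beta> * \<theta>) * r powr \<theta>"
        using pos by (simp add: powr_mult powr_powr)
      moreover have "t * \<beta> * \<theta> = \<beta> * \<theta> * t" by simp
      ultimately show ?thesis unfolding powr_add by (simp only: ac_simps)
    qed
    also have "\<dots> \<le> C\<^sub>2 powr \<theta> * V powr (1 - \<theta>) * (r * L powr (q * t))"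
    proof (intro mult_left_mono mult_mono)
      have "r powr (s + \<theta>) \<le> r powr 1" using pos s by (intro powr_mono') auto
      then show "r powr (s + \<theta>) \<le> r" using pos by simp
      show "L powr (\<beta> * \<theta> * t) \<le> L powr (q * t)" using pos q by (intro powr_mono mult_right_mono) auto
    qed (use pos in auto)
    finally show "?b * r powr s \<le> C\<^sub>2 powr \<theta> * V powr (1 - \<theta>) * r * L powr (q * t)" by (simp add: ac_simps)
    have "?b * ?l powr s \<le> (C\<^sub>2 * L powr (t * \<beta>) * r) * ?l powr s"
      by (intro mult_right_mono) auto
    also have "\<dots> = C\<^sub>2 * C\<^sub>1 powr s * r * (L powr (t * \<beta>) * L powr (- \<alpha> * t * s))"
      using pos by (simp add: powr_mult powr_powr)
    also have "L powr (t * \<beta>) * L powr (- \<alpha> * t * s) = L powr ((\<beta> - \<alpha> * s) * t)"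
      by (simp add: powr_add[symmetric] algebra_simps)
    also have "C\<^sub>2 * C\<^sub>1 powr s * r * L powr ((\<beta> - \<alpha> * s) * t) \<le> C\<^sub>2 * C\<^sub>1 powr s * r * L powr (q * t)"
      using pos q by (intro mult_left_mono powr_mono mult_right_mono) auto
    finally show "?b * ?l powr s \<le> C\<^sub>2 * C\<^sub>1 powr s * r * L powr (q * t)" .
  qed auto
  finally show ?thesis by (simp add: algebra_simps)
qed

lemma common_prefix_length_less_imp_eq:
  "i < common_prefix_length \<omega> \<tau> \<Longrightarrow> \<omega> i = \<tau> i"
  unfolding common_prefix_length_def by (blast dest: not_less_Least)

lemma le_common_prefix_length:
  assumes "\<omega> \<noteq> \<tau>" "\<And>i. i < k \<Longrightarrow> \<omega> i = \<tau> i"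
  shows "k \<le> common_prefix_length \<omega> \<tau>"
proof -
  have "\<omega> (common_prefix_length \<omega> \<tau>) \<noteq> \<tau> (common_prefix_length \<omega> \<tau>)"
    unfolding common_prefix_length_def by (rule LeastI_ex) (use assms(1) in auto)
  then show ?thesis using assms(2) not_le by blast
qed

text \<open>
  The geometric series over the common prefix length \<open>n\<close>. Level \<open>n\<close> is enlarged to the
  whole cylinder \<open>Z n\<close> of the first \<open>n\<close> letters of \<open>\<omega>\<close>, whose mass
  decays like \<open>L\<^bsup>-\<gamma>n\<^esup>\<close>, and \<open>B n\<close> is the ball to which \<open>y\<close> is
  confined.
\<close>

lemma fibre_energy_bound:
  fixes \<eta> :: "real measure" and \<mu> :: "(nat \<Rightarrow> 'a :: {finite, discrete_topology}) measure"
    and P :: "'l \<Rightarrow> (nat \<Rightarrow> 'a) \<Rightarrow> real"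
  assumes "finite_measure \<eta>" and sets_\<eta>: "sets \<eta> = sets borel" and "finite_measure \<mu>"
    and sets_\<mu>: "sets \<mu> = sets (restrict_space borel \<Sigma>)" and "finite_measure \<Lambda>"
    and G: "G \<in> sets \<eta>" and W: "W \<in> sets \<mu>"
    and pos: "C\<^sub>1 > 0" "C\<^sub>2 > 0" "C\<^sub>3 > 0" "c \<ge> 0" "L > 1" "\<beta> > 0"
    and s: "0 \<le> s" "0 \<le> \<theta>" "\<theta> \<le> 1" "1 \<le> s + \<theta>" "\<beta> * \<theta> < \<gamma>" "\<beta> - \<alpha> * s < \<gamma>"
    and balls: "\<And>x r. x \<in> G \<Longrightarrow> r > 0 \<Longrightarrow> measure \<eta> {x - r..x + r} \<le> c * (2 * r) powr s"
    and cylinders: "\<And>\<omega> n. \<omega> \<in> W \<Longrightarrow>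
      measure \<mu> {\<tau> \<in> \<Sigma>. map \<tau> [0..<n] = map \<omega> [0..<n]} \<le> C\<^sub>3 * L powr (- \<gamma> * real n)"
    and close: "\<And>\<omega> \<tau> l. \<omega> \<in> W \<Longrightarrow> \<tau> \<in> W \<Longrightarrow> \<omega> \<noteq> \<tau> \<Longrightarrow> l \<in> space \<Lambda> \<Longrightarrow>
      \<bar>P l \<omega> - P l \<tau>\<bar> \<le> C\<^sub>1 * L powr (- \<alpha> * real (common_prefix_length \<omega> \<tau>))"
    and transversal: "\<And>\<omega> \<tau> r v. \<omega> \<in> W \<Longrightarrow> \<tau> \<in> W \<Longrightarrow> \<omega> \<noteq> \<tau> \<Longrightarrow> r > 0 \<Longrightarrow>
      emeasure \<Lambda> {l \<in> space \<Lambda>. \<bar>v + (P l \<omega> - P l \<tau>)\<bar> \<le> r}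
        \<le> ennreal (C\<^sub>2 * L powr (real (common_prefix_length \<omega> \<tau>) * \<beta>) * r)"
  obtains C where "C \<ge> 0" and "\<And>r x \<omega>. 0 < r \<Longrightarrow> r \<le> 1 \<Longrightarrow> x \<in> G \<Longrightarrow> \<omega> \<in> W \<Longrightarrow>
    (\<integral>\<^sup>+z. emeasure \<Lambda> {l \<in> space \<Lambda>. \<bar>(x + P l \<omega>) - (fst z + P l (snd z))\<bar> \<le> r}
      \<partial>(restrict_space \<eta> G \<Otimes>\<^sub>M restrict_space \<mu> W)) \<le> ennreal (C * r)"
proof -
  interpret E: finite_measure \<eta> by fact
  interpret M: finite_measure \<mu> by fact
  interpret L: finite_measure \<Lambda> by fact
  interpret MW: finite_measure "restrict_space \<mu> W"
    using W by (intro finite_measure_restrict_space M.finite_measure_axioms) auto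
  have space_\<mu>: "space \<mu> = \<Sigma>" using sets_eq_imp_space_eq[OF sets_\<mu>] by (simp add: space_restrict_space)
  have W_sub: "W \<subseteq> \<Sigma>" using sets.sets_into_space[OF W] space_\<mu> by simp
  \<comment> \<open>Adding 1 keeps \<open>V\<close> positive when the parameter space is null.\<close>
  define V where "V = measure \<Lambda> (space \<Lambda>) + 1"
  have V: "V > 0" "\<And>S. emeasure \<Lambda> S \<le> ennreal V"
    unfolding V_def using L.bounded_measure
    by (auto simp: L.emeasure_eq_measure intro!: ennreal_leI add_nonneg_pos add_increasing2)
  define q where "q = max (\<beta> * \<theta>) (\<beta> - \<alpha> * s)"
  have q: "q < \<gamma>" "\<beta> * \<theta> \<le> q" "\<beta> - \<alpha> * s \<le> q" using s by (auto simp: q_def)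
  define z where "z = L powr (q - \<gamma>)"
  have z: "0 \<le> z" "z < 1" using q pos by (auto simp: z_def powr_less_one)
  define K where "K = 4 powr s * (C\<^sub>2 powr \<theta> * V powr (1 - \<theta>) + C\<^sub>2 * C\<^sub>1 powr s) * c * C\<^sub>3"
  have K: "K \<ge> 0" using pos by (simp add: K_def)
  show thesis
  proof (rule that)
    show "K / (1 - z) \<ge> 0" using K z by simp
    fix r x :: real and \<omega> assume r: "0 < r" "r \<le> 1" and x: "x \<in> G" and \<omega>: "\<omega> \<in> W"
    define b where "b n = min (C\<^sub>2 * L powr (real n * \<beta>) * r) V" for n
    define \<rho> where "\<rho> n = r + C\<^sub>1 * L powr (- \<alpha> * real n)" for n
    define B where "B n = {x - \<rho> n..x + \<rho> n} \<inter> G" for n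
    define Z where "Z n = {\<tau> \<in> \<Sigma>. map \<tau> [0..<n] = map \<omega> [0..<n]} \<inter> W" for n
    have b: "b n \<ge> 0" and \<rho>: "\<rho> n > 0" "r \<le> \<rho> n" for n
      using pos r V by (auto simp: b_def \<rho>_def add_pos_pos)
    have B_sets: "B n \<in> sets (restrict_space \<eta> G)" for n
      using G by (auto simp: B_def sets_restrict_space sets_\<eta>)
    have Z_sets: "Z n \<in> sets (restrict_space \<mu> W)" for n
      unfolding Z_def sets_restrict_space
      by (rule image_eqI[OF Int_commute sets_prefix_eq[OF sets_\<mu>]])
    have eB: "emeasure (restrict_space \<eta> G) (B n) \<le> ennreal (c * (2 * \<rho> n) powr s)" for n
    proof -
      have "emeasure (restrict_space \<eta> G) (B n) = emeasure \<eta> (B n)"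
        using G by (subst emeasure_restrict_space) (auto simp: B_def)
      also have "\<dots> \<le> emeasure \<eta> {x - \<rho> n..x + \<rho> n}"
        by (intro emeasure_mono) (auto simp: B_def sets_\<eta>)
      also have "\<dots> \<le> ennreal (c * (2 * \<rho> n) powr s)"
        using balls[OF x \<rho>(1)] by (auto simp: E.emeasure_eq_measure intro: ennreal_leI)
      finally show ?thesis .
    qed
    have eZ: "emeasure (restrict_space \<mu> W) (Z n) \<le> ennreal (C\<^sub>3 * L powr (- \<gamma> * real n))" for n
    proof -
      have "emeasure (restrict_space \<mu> W) (Z n) = emeasure \<mu> (Z n)"
        using W by (subst emeasure_restrict_space) (auto simp: Z_def)
      also have "\<dots> \<le> emeasure \<mu> {\<tau> \<in> \<Sigma>. map \<tau> [0..<n] = map \<omega> [0..<n]}"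
        by (intro emeasure_mono sets_prefix_eq[OF sets_\<mu>]) (auto simp: Z_def)
      also have "\<dots> \<le> ennreal (C\<^sub>3 * L powr (- \<gamma> * real n))"
        using cylinders[OF \<omega>] by (auto simp: M.emeasure_eq_measure intro: ennreal_leI)
      finally show ?thesis .
    qed
    have pointwise: "\<exists>n. emeasure \<Lambda> {l \<in> space \<Lambda>. \<bar>(x + P l \<omega>) - (y + P l \<tau>)\<bar> \<le> r}
        \<le> ennreal (b n) * indicator (B n \<times> Z n) (y, \<tau>)" (is "\<exists>n. emeasure \<Lambda> ?S \<le> _")
      if y: "y \<in> G" and \<tau>: "\<tau> \<in> W" for y \<tau>
    proof (cases "?S = {}")
      case True
      then show ?thesis by (metis emeasure_empty zero_le)
    next
      case False
      then obtain l where l: "l \<in> space \<Lambda>" "\<bar>(x + P l \<omega>) - (y + P l \<tau>)\<bar> \<le> r" by auto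
      show ?thesis
      proof (cases "\<omega> = \<tau>")
        case True
        \<comment> \<open>For \<open>\<tau> = \<omega>\<close> no level is distinguished, but \<open>\<tau>\<close> lies in every cylinder,
        so a level at which the transversality bound exceeds \<open>V\<close> will do.\<close>
        obtain n :: nat where "V / (C\<^sub>2 * r) < (L powr \<beta>) ^ n"
          using real_arch_pow[of "L powr \<beta>"] pos by (auto simp: gr_one_powr)
        then have "V \<le> C\<^sub>2 * L powr (real n * \<beta>) * r"
          using pos r by (simp add: field_simps powr_realpow[symmetric] powr_powr)
        then have "b n = V" by (simp add: b_def)
        moreover have "y \<in> B n" using l True y \<rho>(2)[of n] by (auto simp: B_def)
        moreover have "\<tau> \<in> Z n" using \<tau> True W_sub by (auto simp: Z_def)
        ultimately show ?thesis using V(2) by (intro exI[of _ n]) simp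
      next
        case False
        let ?n = "common_prefix_length \<omega> \<tau>"
        have "y \<in> B ?n" using close[OF \<omega> \<tau> False l(1)] l(2) y by (auto simp: B_def \<rho>_def)
        moreover have "\<tau> \<in> Z ?n"
        proof -
          have "map \<tau> [0..<?n] = map \<omega> [0..<?n]"
            by (rule map_cong) (auto dest: common_prefix_length_less_imp_eq)
          then show ?thesis using \<tau> W_sub by (auto simp: Z_def)
        qed
        moreover have "emeasure \<Lambda> ?S \<le> ennreal (b ?n)"
        proof -
          have "?S = {l \<in> space \<Lambda>. \<bar>(x - y) + (P l \<omega> - P l \<tau>)\<bar> \<le> r}" by (simp add: algebra_simps)
          then show ?thesis using transversal[OF \<omega> \<tau> False r(1), of "x - y"] V(2)[of ?S]
            by (auto simp: b_def min_def)
        qed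
        ultimately show ?thesis by (intro exI[of _ ?n]) simp
      qed
    qed
    have "(\<integral>\<^sup>+p. emeasure \<Lambda> {l \<in> space \<Lambda>. \<bar>(x + P l \<omega>) - (fst p + P l (snd p))\<bar> \<le> r}
          \<partial>(restrict_space \<eta> G \<Otimes>\<^sub>M restrict_space \<mu> W))
        \<le> (\<integral>\<^sup>+p. (\<Sum>n. ennreal (b n) * indicator (B n \<times> Z n) p) \<partial>(restrict_space \<eta> G \<Otimes>\<^sub>M restrict_space \<mu> W))"
    proof (intro nn_integral_mono)
      fix p assume "p \<in> space (restrict_space \<eta> G \<Otimes>\<^sub>M restrict_space \<mu> W)"
      then have "fst p \<in> G" "snd p \<in> W" by (auto simp: space_pair_measure space_restrict_space)
      then obtain n where "emeasure \<Lambda> {l \<in> space \<Lambda>. \<bar>(x + P l \<omega>) - (fst p + P l (snd p))\<bar> \<le> r}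
          \<le> ennreal (b n) * indicator (B n \<times> Z n) (fst p, snd p)"
        using pointwise by blast
      also have "\<dots> \<le> (\<Sum>n. ennreal (b n) * indicator (B n \<times> Z n) p)"
      proof -
        have "f n \<le> (\<Sum>n. f n)" for f :: "nat \<Rightarrow> ennreal"
          using sum_le_suminf[of f "{n}"] by simp
        then show ?thesis by simp
      qed
      finally show "emeasure \<Lambda> {l \<in> space \<Lambda>. \<bar>(x + P l \<omega>) - (fst p + P l (snd p))\<bar> \<le> r} \<le> \<dots>" .
    qed
    also have "\<dots> = (\<Sum>n. ennreal (b n) * emeasure (restrict_space \<eta> G \<Otimes>\<^sub>M restrict_space \<mu> W) (B n \<times> Z n))"
      using B_sets Z_sets by (simp add: nn_integral_suminf nn_integral_cmult_indicator)
    also have "\<dots> \<le> (\<Sum>n. ennreal (K * r * z ^ n))"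
    proof (intro suminf_le summableI)
      fix n
      have "ennreal (b n) * emeasure (restrict_space \<eta> G \<Otimes>\<^sub>M restrict_space \<mu> W) (B n \<times> Z n)
          = ennreal (b n) * (emeasure (restrict_space \<eta> G) (B n) * emeasure (restrict_space \<mu> W) (Z n))"
        by (simp add: MW.emeasure_pair_measure_Times B_sets Z_sets)
      also have "\<dots> \<le> ennreal (b n) * (ennreal (c * (2 * \<rho> n) powr s) * ennreal (C\<^sub>3 * L powr (- \<gamma> * real n)))"
        by (intro mult_left_mono mult_mono eB eZ) auto
      also have "\<dots> = ennreal ((b n * (2 * \<rho> n) powr s) * (c * C\<^sub>3 * L powr (- \<gamma> * real n)))"
        using b pos by (simp add: ennreal_mult[symmetric] ac_simps)
      also have "\<dots> \<le> ennreal (4 powr s * (C\<^sub>2 powr \<theta> * V powr (1 - \<theta>) + C\<^sub>2 * C\<^sub>1 powr s) * r * L powr (q * real n)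
          * (c * C\<^sub>3 * L powr (- \<gamma> * real n)))"
        unfolding b_def \<rho>_def using pos V r s q
        by (intro ennreal_leI mult_right_mono scale_contribution_le) auto
      also have "\<dots> = ennreal (K * r * (L powr (q * real n) * L powr (- \<gamma> * real n)))"
        by (simp add: K_def ac_simps)
      also have "L powr (q * real n) * L powr (- \<gamma> * real n) = z ^ n"
        using pos by (simp add: z_def powr_add[symmetric] powr_realpow[symmetric] powr_powr algebra_simps)
      finally show "ennreal (b n) * emeasure (restrict_space \<eta> G \<Otimes>\<^sub>M restrict_space \<mu> W) (B n \<times> Z n)
          \<le> ennreal (K * r * z ^ n)" .
    qed
    also have "\<dots> = ennreal (K / (1 - z) * r)"
    proof -
      have "(\<lambda>n. K * r * z ^ n) sums (K * r * (1 / (1 - z)))"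
        using z by (intro sums_mult geometric_sums) auto
      then have "(\<Sum>n. ennreal (K * r * z ^ n)) = ennreal (K * r * (1 / (1 - z)))"
        using K r z by (intro suminf_ennreal_eq) auto
      then show ?thesis by (simp add: ac_simps)
    qed
    finally show "(\<integral>\<^sup>+p. emeasure \<Lambda> {l \<in> space \<Lambda>. \<bar>(x + P l \<omega>) - (fst p + P l (snd p))\<bar> \<le> r}
        \<partial>(restrict_space \<eta> G \<Otimes>\<^sub>M restrict_space \<mu> W)) \<le> ennreal (K / (1 - z) * r)" .
  qed
qed

section \<open>From rectangles to the full measure\<close>

text \<open>
  A half-line is the union of the intervals \<open>[a - 2(n + 1), a]\<close>, which have centre
  \<open>a - (n + 1)\<close> and radius \<open>n + 1\<close>.
\<close>

lemma borel_measurable_from_symmetric_intervals: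
  fixes g :: "'l \<Rightarrow> real"
  assumes "\<And>v r. r > 0 \<Longrightarrow> {l \<in> space M. \<bar>v + g l\<bar> \<le> r} \<in> sets M"
  shows "g \<in> borel_measurable M"
proof (rule borel_measurableI_le)
  fix a
  have "{l \<in> space M. g l \<le> a} = (\<Union>n::nat. {l \<in> space M. \<bar>(real n + 1 - a) + g l\<bar> \<le> real n + 1})"
  proof (intro equalityI subsetI)
    fix l assume l: "l \<in> {l \<in> space M. g l \<le> a}"
    obtain n :: nat where "a - g l \<le> real n" using real_arch_simple by blast
    then show "l \<in> (\<Union>n::nat. {l \<in> space M. \<bar>(real n + 1 - a) + g l\<bar> \<le> real n + 1})"
      using l by (intro UN_I[of n]) (auto simp: abs_le_iff)
  qed (auto simp: abs_le_iff)
  also have "\<dots> \<in> sets M" by (intro sets.countable_UN') (auto intro!: assms add_nonneg_pos)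
  finally show "{l \<in> space M. g l \<le> a} \<in> sets M" .
qed

text \<open>
  The parametrised energy criterion for \<open>f l (x, \<omega>) = x + P l \<omega>\<close> on
  \<open>G \<times> W\<close>. The conclusion is phrased by avoidance of null sets, so that the results for
  different rectangles can be combined by intersecting almost sure events.
\<close>

lemma AE_absolutely_continuous_on_rectangle:
  fixes \<eta> :: "real measure" and \<mu> :: "(nat \<Rightarrow> 'a :: {finite, discrete_topology}) measure"
    and P :: "'l \<Rightarrow> (nat \<Rightarrow> 'a) \<Rightarrow> real"
  assumes "finite_measure \<eta>" and sets_\<eta>: "sets \<eta> = sets borel" and "finite_measure \<mu>"
    and sets_\<mu>: "sets \<mu> = sets (restrict_space borel \<Sigma>)" and "finite_measure \<Lambda>"
    and G: "G \<in> sets \<eta>" and W: "W \<in> sets \<mu>"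
    and cont: "\<And>l. l \<in> space \<Lambda> \<Longrightarrow> continuous_on \<Sigma> (P l)"
    and meas: "\<And>\<omega> \<tau>. \<omega> \<in> W \<Longrightarrow> \<tau> \<in> W \<Longrightarrow> (\<lambda>l. P l \<omega> - P l \<tau>) \<in> borel_measurable \<Lambda>"
    and "C \<ge> 0" and energy: "\<And>r x \<omega>. 0 < r \<Longrightarrow> r \<le> 1 \<Longrightarrow> x \<in> G \<Longrightarrow> \<omega> \<in> W \<Longrightarrow>
      (\<integral>\<^sup>+z. emeasure \<Lambda> {l \<in> space \<Lambda>. \<bar>(x + P l \<omega>) - (fst z + P l (snd z))\<bar> \<le> r}
        \<partial>(restrict_space \<eta> G \<Otimes>\<^sub>M restrict_space \<mu> W)) \<le> ennreal (C * r)"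
  shows "AE l in \<Lambda>. \<forall>N\<in>null_sets lborel.
    AE x in \<eta>. x \<in> G \<longrightarrow> (AE \<omega> in \<mu>. \<omega> \<in> W \<longrightarrow> x + P l \<omega> \<notin> N)"
proof -
  interpret E: finite_measure \<eta> by fact
  interpret M: finite_measure \<mu> by fact
  interpret L: finite_measure \<Lambda> by fact
  let ?E = "restrict_space \<eta> G" and ?W = "restrict_space \<mu> W"
  interpret MW: finite_measure ?W
    using W by (intro finite_measure_restrict_space M.finite_measure_axioms) auto
  interpret EG: finite_measure ?E
    using G by (intro finite_measure_restrict_space E.finite_measure_axioms) auto
  interpret EW: pair_sigma_finite ?E ?W ..
  let ?M = "?E \<Otimes>\<^sub>M ?W"
  have [measurable]: "(\<lambda>x. x) \<in> borel_measurable ?E"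
    by (intro measurable_restrict_space1) (simp add: measurable_def sets_\<eta> sets_eq_imp_space_eq[OF sets_\<eta>])
  have P_meas: "P l \<in> borel_measurable ?W" if "l \<in> space \<Lambda>" for l
    using borel_measurable_continuous_on_restrict[OF cont[OF that]]
    by (intro measurable_restrict_space1) (simp add: measurable_cong_sets[OF sets_\<mu> refl])
  have shifted: "(\<lambda>p. fst p + P l (snd p)) \<in> borel_measurable ?M" if "l \<in> space \<Lambda>" for l
    using P_meas[OF that] by measurable
  have "AE l in \<Lambda>. absolutely_continuous lborel (distr ?M borel (\<lambda>p. fst p + P l (snd p)))"
  proof (rule AE_absolutely_continuous_distr)
    show "sigma_finite_measure \<Lambda>" ..
    show "finite_measure ?M" by (intro finite_measure_pair_measure) unfold_locales
    have "(\<lambda>z. (fst z, (snd (fst (snd z)), snd (snd (snd z))))) \<in> measurable (\<Lambda> \<Otimes>\<^sub>M (?M \<Otimes>\<^sub>M ?M)) (\<Lambda> \<Otimes>\<^sub>M (?W \<Otimes>\<^sub>M ?W))"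
      by measurable
    from measurable_compose[OF this measurable_differences_from_prefixes[OF sets_\<mu> W cont meas]]
    have [measurable]: "(\<lambda>z. P (fst z) (snd (fst (snd z))) - P (fst z) (snd (snd (snd z))))
        \<in> borel_measurable (\<Lambda> \<Otimes>\<^sub>M (?M \<Otimes>\<^sub>M ?M))" by simp
    have "(\<lambda>z. (fst (fst (snd z)) - fst (snd (snd z)))
          + (P (fst z) (snd (fst (snd z))) - P (fst z) (snd (snd (snd z)))))
        \<in> borel_measurable (\<Lambda> \<Otimes>\<^sub>M (?M \<Otimes>\<^sub>M ?M))"
      by measurable
    then show "(\<lambda>z. (fst (fst (snd z)) + P (fst z) (snd (fst (snd z))))
          - (fst (snd (snd z)) + P (fst z) (snd (snd (snd z)))))
        \<in> borel_measurable (\<Lambda> \<Otimes>\<^sub>M (?M \<Otimes>\<^sub>M ?M))"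
      by (simp add: algebra_simps)
    show "C \<ge> 0" by fact
    fix r :: real and p assume "0 < r" "r \<le> 1" "p \<in> space ?M"
    then show "(\<integral>\<^sup>+q. emeasure \<Lambda> {l \<in> space \<Lambda>. \<bar>(fst p + P l (snd p)) - (fst q + P l (snd q))\<bar> \<le> r} \<partial>?M)
        \<le> ennreal (C * r)"
      by (intro energy) (auto simp: space_pair_measure space_restrict_space)
  qed (rule shifted)
  then show ?thesis
  proof (rule AE_mp[OF _ AE_I2], intro impI ballI)
    fix l and N :: "real set" assume l: "l \<in> space \<Lambda>" and N: "N \<in> null_sets lborel"
      and "absolutely_continuous lborel (distr ?M borel (\<lambda>p. fst p + P l (snd p)))"
    then have "N \<in> null_sets (distr ?M borel (\<lambda>p. fst p + P l (snd p)))"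
      by (auto simp: absolutely_continuous_def)
    then have "AE y in distr ?M borel (\<lambda>p. fst p + P l (snd p)). y \<notin> N" by (rule AE_not_in)
    then have "AE p in ?M. fst p + P l (snd p) \<notin> N"
      using N by (subst (asm) AE_distr_iff[OF shifted[OF l]]) auto
    from EW.AE_pair[OF this] have "AE x in ?E. AE \<omega> in ?W. x + P l \<omega> \<notin> N" by simp
    then show "AE x in \<eta>. x \<in> G \<longrightarrow> (AE \<omega> in \<mu>. \<omega> \<in> W \<longrightarrow> x + P l \<omega> \<notin> N)"
      using G W by (simp add: AE_restrict_space_iff)
  qed
qed

text \<open>
  The rectangles \<open>G m \<times> W u\<close>, where \<open>u\<close> runs through the words of length
  \<open>k\<^sub>0\<close>, cover almost all of \<open>\<real> \<times> \<Omega>\<close>. Inside \<open>W u\<close> distinct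
  sequences agree on the first \<open>k\<^sub>0\<close> letters, so the transversality condition holds for all distinct pairs.
\<close>

lemma AE_null_sets_avoided_on_good_set:
  fixes \<eta> :: "real measure" and \<mu> :: "(nat \<Rightarrow> 'a :: {finite, discrete_topology}) measure"
    and P :: "'l \<Rightarrow> (nat \<Rightarrow> 'a) \<Rightarrow> real"
  assumes "prob_space \<eta>" and sets_\<eta>: "sets \<eta> = sets borel" and dim: "exact_local_dimension \<eta> d"
    and "prob_space \<mu>" and sets_\<mu>: "sets \<mu> = sets (restrict_space borel \<Sigma>)" and "finite_measure \<Lambda>"
    and \<Omega>: "\<Omega> \<in> sets \<mu>"
    and cont: "\<And>l. l \<in> space \<Lambda> \<Longrightarrow> continuous_on \<Sigma> (P l)"
    and pos: "C\<^sub>1 > 0" "C\<^sub>2 > 0" "C\<^sub>3 > 0" "L > 1" "\<alpha> > 0" "\<beta> > 0" "\<gamma> > 0"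
    and dims: "d + \<gamma> / \<beta> > 1" "d > (\<beta> - \<gamma>) / \<alpha>"
    and close: "\<And>\<omega> \<tau> l. \<omega> \<in> \<Omega> \<Longrightarrow> \<tau> \<in> \<Omega> \<Longrightarrow> \<omega> \<noteq> \<tau> \<Longrightarrow> l \<in> space \<Lambda> \<Longrightarrow>
      \<bar>P l \<omega> - P l \<tau>\<bar> \<le> C\<^sub>1 * L powr (- \<alpha> * real (common_prefix_length \<omega> \<tau>))"
    and meas: "\<And>\<omega> \<tau>. \<omega> \<in> \<Omega> \<Longrightarrow> \<tau> \<in> \<Omega> \<Longrightarrow> \<omega> \<noteq> \<tau> \<Longrightarrow> k\<^sub>0 \<le> common_prefix_length \<omega> \<tau> \<Longrightarrow>
      (\<lambda>l. P l \<omega> - P l \<tau>) \<in> borel_measurable \<Lambda>"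
    and transversal: "\<And>\<omega> \<tau> r v. \<omega> \<in> \<Omega> \<Longrightarrow> \<tau> \<in> \<Omega> \<Longrightarrow> \<omega> \<noteq> \<tau> \<Longrightarrow> k\<^sub>0 \<le> common_prefix_length \<omega> \<tau> \<Longrightarrow> r > 0 \<Longrightarrow>
      emeasure \<Lambda> {l \<in> space \<Lambda>. \<bar>v + (P l \<omega> - P l \<tau>)\<bar> \<le> r}
        \<le> ennreal (C\<^sub>2 * L powr (real (common_prefix_length \<omega> \<tau>) * \<beta>) * r)"
    and cylinders: "\<And>\<omega> n. \<omega> \<in> \<Omega> \<Longrightarrow> n \<ge> 1 \<Longrightarrow>
      measure \<mu> {\<tau> \<in> \<Sigma>. map \<tau> [0..<n] = map \<omega> [0..<n]} \<le> C\<^sub>3 * L powr (- \<gamma> * real n)"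
  shows "AE l in \<Lambda>. \<forall>N\<in>null_sets lborel. AE x in \<eta>. AE \<omega> in \<mu>. \<omega> \<in> \<Omega> \<longrightarrow> x + P l \<omega> \<notin> N"
proof -
  interpret E: prob_space \<eta> by fact
  interpret M: prob_space \<mu> by fact
  have space_\<mu>: "space \<mu> = \<Sigma>" using sets_eq_imp_space_eq[OF sets_\<mu>] by (simp add: space_restrict_space)
  have \<Omega>_sub: "\<Omega> \<subseteq> \<Sigma>" using sets.sets_into_space[OF \<Omega>] space_\<mu> by simp
  obtain s \<theta> where s: "0 \<le> s" "s = 0 \<or> s < d" "0 \<le> \<theta>" "\<theta> \<le> 1" "1 \<le> s + \<theta>"
    "\<beta> * \<theta> < \<gamma>" "\<beta> - \<alpha> * s < \<gamma>"
    using exponents_exist[OF exact_local_dimension_nonneg[OF \<open>prob_space \<eta>\<close> dim] pos(5-7) dims] by metis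
  obtain G :: "nat \<Rightarrow> real set" where G: "\<And>m. G m \<in> sets borel"
    and balls: "\<And>m x r. x \<in> G m \<Longrightarrow> r > 0 \<Longrightarrow> measure \<eta> {x - r..x + r} \<le> real m * (2 * r) powr s"
    and G_AE: "AE x in \<eta>. \<exists>m. x \<in> G m"
    using exact_local_dimension_uniform_balls[OF \<open>prob_space \<eta>\<close> sets_\<eta> dim s(1,2)] by metis
  define U :: "'a list set" where "U = {u. length u = k\<^sub>0}"
  have "finite U" using finite_lists_length_eq[of "UNIV :: 'a set" k\<^sub>0] by (simp add: U_def)
  define W where "W u = \<Omega> \<inter> {\<omega> \<in> \<Sigma>. map \<omega> [0..<k\<^sub>0] = u}" for u
  have W_sets: "W u \<in> sets \<mu>" for u
    unfolding W_def by (intro sets.Int \<Omega> sets_prefix_eq[OF sets_\<mu>])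
  have W_prefix: "k\<^sub>0 \<le> common_prefix_length \<omega> \<tau>" if "\<omega> \<in> W u" "\<tau> \<in> W u" "\<omega> \<noteq> \<tau>" for \<omega> \<tau> u
  proof (rule le_common_prefix_length[OF that(3)])
    fix i assume "i < k\<^sub>0"
    then show "\<omega> i = \<tau> i" using that(1,2) by (auto simp: W_def map_eq_conv)
  qed
  have "AE l in \<Lambda>. \<forall>N\<in>null_sets lborel.
      AE x in \<eta>. x \<in> G m \<longrightarrow> (AE \<omega> in \<mu>. \<omega> \<in> W u \<longrightarrow> x + P l \<omega> \<notin> N)" for m u
  proof -
    have W\<Omega>: "\<omega> \<in> \<Omega>" if "\<omega> \<in> W u" for \<omega> using that by (simp add: W_def)
    have meas_W: "(\<lambda>l. P l \<omega> - P l \<tau>) \<in> borel_measurable \<Lambda>" if "\<omega> \<in> W u" "\<tau> \<in> W u" for \<omega> \<tau>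
      using meas[OF W\<Omega>[OF that(1)] W\<Omega>[OF that(2)]] W_prefix[OF that] by (cases "\<omega> = \<tau>") auto
    \<comment> \<open>The constant \<open>max C\<^sub>3 1\<close> covers the empty word as well.\<close>
    have cyl: "measure \<mu> {\<tau> \<in> \<Sigma>. map \<tau> [0..<n] = map \<omega> [0..<n]} \<le> max C\<^sub>3 1 * L powr (- \<gamma> * real n)"
      if "\<omega> \<in> W u" for \<omega> n
    proof (cases "n = 0")
      case True
      then show ?thesis using M.prob_le_1 pos by (auto intro: order_trans[OF M.prob_le_1])
    next
      case False
      then have "measure \<mu> {\<tau> \<in> \<Sigma>. map \<tau> [0..<n] = map \<omega> [0..<n]} \<le> C\<^sub>3 * L powr (- \<gamma> * real n)"
        using W\<Omega>[OF that] by (intro cylinders) auto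
      also have "\<dots> \<le> max C\<^sub>3 1 * L powr (- \<gamma> * real n)" by (intro mult_right_mono) auto
      finally show ?thesis .
    qed
    have close_W: "\<bar>P l \<omega> - P l \<tau>\<bar> \<le> C\<^sub>1 * L powr (- \<alpha> * real (common_prefix_length \<omega> \<tau>))"
      if "\<omega> \<in> W u" "\<tau> \<in> W u" "\<omega> \<noteq> \<tau>" "l \<in> space \<Lambda>" for \<omega> \<tau> l
      by (rule close) (use that W\<Omega> in auto)
    have transversal_W: "emeasure \<Lambda> {l \<in> space \<Lambda>. \<bar>v + (P l \<omega> - P l \<tau>)\<bar> \<le> r}
        \<le> ennreal (C\<^sub>2 * L powr (real (common_prefix_length \<omega> \<tau>) * \<beta>) * r)"
      if "\<omega> \<in> W u" "\<tau> \<in> W u" "\<omega> \<noteq> \<tau>" "r > 0" for \<omega> \<tau> r v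
      by (rule transversal) (use that W\<Omega> W_prefix in auto)
    have G_sets: "G m \<in> sets \<eta>" using G by (simp add: sets_\<eta>)
    obtain C where "C \<ge> 0" "\<And>r x \<omega>. 0 < r \<Longrightarrow> r \<le> 1 \<Longrightarrow> x \<in> G m \<Longrightarrow> \<omega> \<in> W u \<Longrightarrow>
      (\<integral>\<^sup>+z. emeasure \<Lambda> {l \<in> space \<Lambda>. \<bar>(x + P l \<omega>) - (fst z + P l (snd z))\<bar> \<le> r}
        \<partial>(restrict_space \<eta> (G m) \<Otimes>\<^sub>M restrict_space \<mu> (W u))) \<le> ennreal (C * r)"
      by (rule fibre_energy_bound[OF E.finite_measure_axioms sets_\<eta> M.finite_measure_axioms sets_\<mu>
            \<open>finite_measure \<Lambda>\<close> G_sets W_sets pos(1,2) _ _ pos(4,6) s(1,3-7) balls cyl close_W transversal_W]) auto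
    then show ?thesis
      using G W_sets meas_W cont
      by (intro AE_absolutely_continuous_on_rectangle[OF E.finite_measure_axioms sets_\<eta> M.finite_measure_axioms
            sets_\<mu> \<open>finite_measure \<Lambda>\<close>]) (auto simp: sets_\<eta>)
  qed
  then have "AE l in \<Lambda>. \<forall>m. \<forall>u\<in>U. \<forall>N\<in>null_sets lborel.
      AE x in \<eta>. x \<in> G m \<longrightarrow> (AE \<omega> in \<mu>. \<omega> \<in> W u \<longrightarrow> x + P l \<omega> \<notin> N)"
    using \<open>finite U\<close> by (simp add: AE_all_countable AE_finite_all)
  then show ?thesis
  proof (rule AE_mp[OF _ AE_I2], intro impI ballI)
    fix l and N :: "real set" assume N: "N \<in> null_sets lborel"
      and "\<forall>m. \<forall>u\<in>U. \<forall>N\<in>null_sets lborel.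
        AE x in \<eta>. x \<in> G m \<longrightarrow> (AE \<omega> in \<mu>. \<omega> \<in> W u \<longrightarrow> x + P l \<omega> \<notin> N)"
    then have "AE x in \<eta>. \<forall>m. \<forall>u\<in>U. x \<in> G m \<longrightarrow> (AE \<omega> in \<mu>. \<omega> \<in> W u \<longrightarrow> x + P l \<omega> \<notin> N)"
      using \<open>finite U\<close> N by (intro AE_all_countable[THEN iffD2, rule_format] AE_finite_allI) auto
    with G_AE show "AE x in \<eta>. AE \<omega> in \<mu>. \<omega> \<in> \<Omega> \<longrightarrow> x + P l \<omega> \<notin> N"
    proof eventually_elim
      fix x assume "\<exists>m. x \<in> G m" "\<forall>m. \<forall>u\<in>U. x \<in> G m \<longrightarrow> (AE \<omega> in \<mu>. \<omega> \<in> W u \<longrightarrow> x + P l \<omega> \<notin> N)"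
      then have "AE \<omega> in \<mu>. \<forall>u\<in>U. \<omega> \<in> W u \<longrightarrow> x + P l \<omega> \<notin> N"
        using \<open>finite U\<close> by (intro AE_finite_allI) auto
      then show "AE \<omega> in \<mu>. \<omega> \<in> \<Omega> \<longrightarrow> x + P l \<omega> \<notin> N"
      proof eventually_elim
        fix \<omega> assume H: "\<forall>u\<in>U. \<omega> \<in> W u \<longrightarrow> x + P l \<omega> \<notin> N"
        show "\<omega> \<in> \<Omega> \<longrightarrow> x + P l \<omega> \<notin> N"
          using H[rule_format, of "map \<omega> [0..<k\<^sub>0]"] \<Omega>_sub by (auto simp: U_def W_def)
      qed
    qed
  qed
qed

section \<open>Absolute continuity for almost every parameter\<close>

text \<open>
  The good sets for \<open>\<epsilon> = 1/(j + 1)\<close> together have full measure. Each has its own constants, and each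
  has a null set of exceptional parameters; the union of these null sets over all \<open>j\<close> is still null.
\<close>

theorem proposition2p3:
  fixes A :: "((real, 'a :: {finite, discrete_topology}) vec, 'a) vec"
    and \<mu> :: "(nat \<Rightarrow> 'a) measure"
    and \<Sigma> :: "(nat \<Rightarrow> 'a) set"
    and P :: "real \<Rightarrow> (nat \<Rightarrow> 'a) \<Rightarrow> real"
    and l\<^sub>0 l\<^sub>1 :: real
    and J :: "real set"
    and \<nu> :: "real \<Rightarrow> real measure"
    and \<eta> :: "real measure"
    and d\<^sub>\<eta> L :: real
  defines "L \<equiv> real CARD('a)"
    and "\<Sigma> \<equiv> markov_chain A"
    and "J \<equiv> {l\<^sub>0..l\<^sub>1}"
    and "\<nu> \<equiv> (\<lambda>l. distr \<mu> borel (P l))"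
  assumes "CARD('a) \<ge> 2"
    and "zero_one_matrix A" and "primitive_matrix A"
    and "prob_space \<mu>" and "sets \<mu> = sets (restrict_space borel \<Sigma>)"
    and "l\<^sub>0 \<le> l\<^sub>1"
    and "\<And>l. l \<in> J \<Longrightarrow> continuous_on \<Sigma> (P l)"
    and "\<And>l. l \<in> J \<Longrightarrow> Cantor_set (P l ` \<Sigma>)"
    and "prob_space \<eta>" and "sets \<eta> = sets borel"
    and "compactly_supported \<eta>" and "exact_local_dimension \<eta> d\<^sub>\<eta>"
    and "\<And>\<epsilon>::real. \<epsilon> > 0 \<Longrightarrow>
      \<exists>\<Omega> \<in> sets \<mu>. measure \<mu> \<Omega> > 1 - \<epsilon> \<and>
        (\<exists>(C\<^sub>1::real) (C\<^sub>2::real) (C\<^sub>3::real) (\<alpha>::real) (\<beta>::real) (\<gamma>::real) (k\<^sub>0::nat).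
           C\<^sub>1 > 0 \<and> C\<^sub>2 > 0 \<and> C\<^sub>3 > 0 \<and> \<alpha> > 0 \<and> \<beta> > 0 \<and> \<gamma> > 0 \<and>
           d\<^sub>\<eta> + \<gamma> / \<beta> > 1 \<and> d\<^sub>\<eta> > (\<beta> - \<gamma>) / \<alpha> \<and>
           (\<forall>\<omega>\<in>\<Omega>. \<forall>\<tau>\<in>\<Omega>. \<omega> \<noteq> \<tau> \<longrightarrow>
              (\<forall>l\<in>J. \<bar>proj_diff P \<omega> \<tau> l\<bar>
                 \<le> C\<^sub>1 * L powr (- \<alpha> * real (common_prefix_length \<omega> \<tau>)))) \<and>
           (\<forall>r>0. \<forall>\<omega>\<in>\<Omega>. \<forall>\<tau>\<in>\<Omega>. \<omega> \<noteq> \<tau> \<and> common_prefix_length \<omega> \<tau> \<ge> k\<^sub>0 \<longrightarrow>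
              (\<forall>v. {l \<in> J. \<bar>v + proj_diff P \<omega> \<tau> l\<bar> \<le> r} \<in> sets lebesgue) \<and>
              (SUP v. emeasure lebesgue {l \<in> J. \<bar>v + proj_diff P \<omega> \<tau> l\<bar> \<le> r})
                 \<le> ennreal (C\<^sub>2 * L powr (real (common_prefix_length \<omega> \<tau>) * \<beta>) * r)) \<and>
           (\<forall>n\<ge>1. \<forall>u. length u = n \<and> cylinder \<Sigma> u \<inter> \<Omega> \<noteq> {} \<longrightarrow>
              measure \<mu> (cylinder \<Sigma> u) \<le> C\<^sub>3 * L powr (- \<gamma> * real n)))"
  shows "AE l in lebesgue. l \<in> J \<longrightarrow> absolutely_continuous lborel (\<eta> \<star> \<nu> l)"
proof -
  interpret M: prob_space \<mu> by fact
  interpret E: prob_space \<eta> by fact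
  note sets_\<mu> = \<open>sets \<mu> = sets (restrict_space borel \<Sigma>)\<close>
  have space_\<mu>: "space \<mu> = \<Sigma>" using sets_eq_imp_space_eq[OF sets_\<mu>] by (simp add: space_restrict_space)
  have L: "L > 1" using \<open>CARD('a) \<ge> 2\<close> by (simp add: L_def)
  let ?\<Lambda> = "lebesgue_on J"
  have J_sets: "J \<in> sets lebesgue" and space_\<Lambda>: "space ?\<Lambda> = J" by (simp_all add: J_def space_restrict_space)
  have finite_\<Lambda>: "finite_measure ?\<Lambda>" unfolding J_def by (intro finite_measure_lebesgue_on) simp
  have good_set: "\<exists>\<Omega>\<in>sets \<mu>. measure \<mu> \<Omega> > 1 - \<epsilon> \<and>
      (AE l in ?\<Lambda>. \<forall>N\<in>null_sets lborel. AE x in \<eta>. AE \<omega> in \<mu>. \<omega> \<in> \<Omega> \<longrightarrow> x + P l \<omega> \<notin> N)"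
    if eps: "\<epsilon> > 0" for \<epsilon> :: real
  proof -
    obtain \<Omega> C\<^sub>1 C\<^sub>2 C\<^sub>3 \<alpha> \<beta> \<gamma> and k\<^sub>0 :: nat where \<Omega>: "\<Omega> \<in> sets \<mu>" "measure \<mu> \<Omega> > 1 - \<epsilon>"
      and pos: "C\<^sub>1 > 0" "C\<^sub>2 > 0" "C\<^sub>3 > 0" "\<alpha> > 0" "\<beta> > 0" "\<gamma> > 0"
      and dims: "d\<^sub>\<eta> + \<gamma> / \<beta> > 1" "d\<^sub>\<eta> > (\<beta> - \<gamma>) / \<alpha>"
      and close: "\<forall>\<omega>\<in>\<Omega>. \<forall>\<tau>\<in>\<Omega>. \<omega> \<noteq> \<tau> \<longrightarrow> (\<forall>l\<in>J. \<bar>proj_diff P \<omega> \<tau> l\<bar>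
                 \<le> C\<^sub>1 * L powr (- \<alpha> * real (common_prefix_length \<omega> \<tau>)))"
      and trans: "\<forall>r>0. \<forall>\<omega>\<in>\<Omega>. \<forall>\<tau>\<in>\<Omega>. \<omega> \<noteq> \<tau> \<and> common_prefix_length \<omega> \<tau> \<ge> k\<^sub>0 \<longrightarrow>
              (\<forall>v. {l \<in> J. \<bar>v + proj_diff P \<omega> \<tau> l\<bar> \<le> r} \<in> sets lebesgue) \<and>
              (SUP v. emeasure lebesgue {l \<in> J. \<bar>v + proj_diff P \<omega> \<tau> l\<bar> \<le> r})
                 \<le> ennreal (C\<^sub>2 * L powr (real (common_prefix_length \<omega> \<tau>) * \<beta>) * r)"
      and cyl: "\<forall>n\<ge>1. \<forall>u. length u = n \<and> cylinder \<Sigma> u \<inter> \<Omega> \<noteq> {} \<longrightarrow>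
              measure \<mu> (cylinder \<Sigma> u) \<le> C\<^sub>3 * L powr (- \<gamma> * real n)"
      using assms(17)[OF eps] by (elim bexE exE conjE) (rule that; assumption)
    have \<Omega>_sub: "\<Omega> \<subseteq> \<Sigma>" using sets.sets_into_space[OF \<Omega>(1)] space_\<mu> by simp
    have level_sets: "{l \<in> J. \<bar>v + (P l \<omega> - P l \<tau>)\<bar> \<le> r} \<in> sets lebesgue"
      and level_le: "emeasure lebesgue {l \<in> J. \<bar>v + (P l \<omega> - P l \<tau>)\<bar> \<le> r}
        \<le> ennreal (C\<^sub>2 * L powr (real (common_prefix_length \<omega> \<tau>) * \<beta>) * r)"
      if "\<omega> \<in> \<Omega>" "\<tau> \<in> \<Omega>" "\<omega> \<noteq> \<tau>" "k\<^sub>0 \<le> common_prefix_length \<omega> \<tau>" "r > 0" for \<omega> \<tau> r v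
    proof -
      have T: "{l \<in> J. \<bar>v + proj_diff P \<omega> \<tau> l\<bar> \<le> r} \<in> sets lebesgue"
        "(SUP v. emeasure lebesgue {l \<in> J. \<bar>v + proj_diff P \<omega> \<tau> l\<bar> \<le> r})
           \<le> ennreal (C\<^sub>2 * L powr (real (common_prefix_length \<omega> \<tau>) * \<beta>) * r)"
        using trans that by blast+
      show "{l \<in> J. \<bar>v + (P l \<omega> - P l \<tau>)\<bar> \<le> r} \<in> sets lebesgue" using T(1) by (simp add: proj_diff_def)
      have "emeasure lebesgue {l \<in> J. \<bar>v + proj_diff P \<omega> \<tau> l\<bar> \<le> r}
          \<le> (SUP v. emeasure lebesgue {l \<in> J. \<bar>v + proj_diff P \<omega> \<tau> l\<bar> \<le> r})"
        by (rule SUP_upper) simp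
      also note T(2)
      finally show "emeasure lebesgue {l \<in> J. \<bar>v + (P l \<omega> - P l \<tau>)\<bar> \<le> r}
        \<le> ennreal (C\<^sub>2 * L powr (real (common_prefix_length \<omega> \<tau>) * \<beta>) * r)" by (simp add: proj_diff_def)
    qed
    have "AE l in ?\<Lambda>. \<forall>N\<in>null_sets lborel. AE x in \<eta>. AE \<omega> in \<mu>. \<omega> \<in> \<Omega> \<longrightarrow> x + P l \<omega> \<notin> N"
    proof (rule AE_null_sets_avoided_on_good_set[OF \<open>prob_space \<eta>\<close> \<open>sets \<eta> = sets borel\<close>
          \<open>exact_local_dimension \<eta> d\<^sub>\<eta>\<close> \<open>prob_space \<mu>\<close> sets_\<mu> finite_\<Lambda> \<Omega>(1) _ pos(1-3) L pos(4-6) dims])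
      show "continuous_on \<Sigma> (P l)" if "l \<in> space ?\<Lambda>" for l using that assms(11) space_\<Lambda> by simp
      show "\<bar>P l \<omega> - P l \<tau>\<bar> \<le> C\<^sub>1 * L powr (- \<alpha> * real (common_prefix_length \<omega> \<tau>))"
        if "\<omega> \<in> \<Omega>" "\<tau> \<in> \<Omega>" "\<omega> \<noteq> \<tau>" "l \<in> space ?\<Lambda>" for \<omega> \<tau> l
        using close that space_\<Lambda> unfolding proj_diff_def by blast
      show "(\<lambda>l. P l \<omega> - P l \<tau>) \<in> borel_measurable ?\<Lambda>"
        if "\<omega> \<in> \<Omega>" "\<tau> \<in> \<Omega>" "\<omega> \<noteq> \<tau>" "k\<^sub>0 \<le> common_prefix_length \<omega> \<tau>" for \<omega> \<tau>
      proof (rule borel_measurable_from_symmetric_intervals)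
        show "{l \<in> space ?\<Lambda>. \<bar>v + (P l \<omega> - P l \<tau>)\<bar> \<le> r} \<in> sets ?\<Lambda>" if "r > 0" for v r
          unfolding space_\<Lambda> using level_sets[OF \<open>\<omega> \<in> \<Omega>\<close> \<open>\<tau> \<in> \<Omega>\<close> \<open>\<omega> \<noteq> \<tau>\<close> \<open>k\<^sub>0 \<le> _\<close> that] J_sets
          by (subst sets_restrict_space_iff) auto
      qed
      show "emeasure ?\<Lambda> {l \<in> space ?\<Lambda>. \<bar>v + (P l \<omega> - P l \<tau>)\<bar> \<le> r}
          \<le> ennreal (C\<^sub>2 * L powr (real (common_prefix_length \<omega> \<tau>) * \<beta>) * r)"
        if "\<omega> \<in> \<Omega>" "\<tau> \<in> \<Omega>" "\<omega> \<noteq> \<tau>" "k\<^sub>0 \<le> common_prefix_length \<omega> \<tau>" "r > 0" for \<omega> \<tau> r v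
        unfolding space_\<Lambda> using level_le[OF that] J_sets by (subst emeasure_restrict_space) auto
      show "measure \<mu> {\<tau> \<in> \<Sigma>. map \<tau> [0..<n] = map \<omega> [0..<n]} \<le> C\<^sub>3 * L powr (- \<gamma> * real n)"
        if "\<omega> \<in> \<Omega>" "n \<ge> 1" for \<omega> n
      proof -
        have nonempty: "cylinder \<Sigma> (map \<omega> [0..<n]) \<inter> \<Omega> \<noteq> {}"
          using that \<Omega>_sub by (auto simp: cylinder_def)
        have "measure \<mu> (cylinder \<Sigma> (map \<omega> [0..<n])) \<le> C\<^sub>3 * L powr (- \<gamma> * real n)"
          by (rule cyl[rule_format, OF that(2)]) (use nonempty in simp)
        then show ?thesis by (simp add: cylinder_def)
      qed
    qed
    then show ?thesis using \<Omega> by blast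
  qed
  have "\<exists>\<Omega>. \<forall>j::nat. \<Omega> j \<in> sets \<mu> \<and> measure \<mu> (\<Omega> j) > 1 - inverse (real (Suc j)) \<and>
      (AE l in ?\<Lambda>. \<forall>N\<in>null_sets lborel. AE x in \<eta>. AE \<omega> in \<mu>. \<omega> \<in> \<Omega> j \<longrightarrow> x + P l \<omega> \<notin> N)"
    by (intro choice allI) (use good_set in \<open>simp add: Bex_def\<close>)
  then obtain \<Omega> :: "nat \<Rightarrow> (nat \<Rightarrow> 'a) set" where \<Omega>: "\<And>j. \<Omega> j \<in> sets \<mu>"
      "\<And>j. measure \<mu> (\<Omega> j) > 1 - inverse (real (Suc j))"
      "\<And>j. AE l in ?\<Lambda>. \<forall>N\<in>null_sets lborel. AE x in \<eta>. AE \<omega> in \<mu>. \<omega> \<in> \<Omega> j \<longrightarrow> x + P l \<omega> \<notin> N"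
    by blast
  have exhaust: "AE \<omega> in \<mu>. \<exists>j. \<omega> \<in> \<Omega> j"
  proof -
    have [measurable]: "(\<Union>j. \<Omega> j) \<in> sets \<mu>" using \<Omega>(1) by auto
    have "1 - inverse (real (Suc j)) \<le> measure \<mu> (\<Union>j. \<Omega> j)" for j
      using \<Omega>(2)[of j] M.finite_measure_mono[of "\<Omega> j" "\<Union>j. \<Omega> j"] by fastforce
    moreover have "(\<lambda>j. 1 - inverse (real (Suc j))) \<longlonglongrightarrow> 1"
      using tendsto_diff[OF tendsto_const LIMSEQ_inverse_real_of_nat, of "1::real"] by simp
    ultimately have "1 \<le> measure \<mu> (\<Union>j. \<Omega> j)" by (intro LIMSEQ_le_const2) auto
    then have "measure \<mu> (\<Union>j. \<Omega> j) = 1" using M.prob_le_1 by (simp add: order_antisym)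
    then have "AE \<omega> in \<mu>. \<omega> \<in> (\<Union>j. \<Omega> j)" by (rule M.AE_prob_1)
    then show ?thesis by simp
  qed
  have "AE l in ?\<Lambda>. \<forall>j. \<forall>N\<in>null_sets lborel. AE x in \<eta>. AE \<omega> in \<mu>. \<omega> \<in> \<Omega> j \<longrightarrow> x + P l \<omega> \<notin> N"
    using \<Omega>(3) by (simp add: AE_all_countable)
  then have "AE l in lebesgue. l \<in> J \<longrightarrow>
      (\<forall>j. \<forall>N\<in>null_sets lborel. AE x in \<eta>. AE \<omega> in \<mu>. \<omega> \<in> \<Omega> j \<longrightarrow> x + P l \<omega> \<notin> N)"
    using J_sets by (simp add: AE_restrict_space_iff)
  then show ?thesis
  proof eventually_elim
    fix l assume H: "l \<in> J \<longrightarrow>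
      (\<forall>j. \<forall>N\<in>null_sets lborel. AE x in \<eta>. AE \<omega> in \<mu>. \<omega> \<in> \<Omega> j \<longrightarrow> x + P l \<omega> \<notin> N)"
    show "l \<in> J \<longrightarrow> absolutely_continuous lborel (\<eta> \<star> \<nu> l)"
      unfolding absolutely_continuous_def
    proof (intro impI subsetI)
      fix N :: "real set" assume l: "l \<in> J" and N: "N \<in> null_sets lborel"
      have [measurable]: "N \<in> sets borel" using N by auto
      have P_meas [measurable]: "P l \<in> borel_measurable \<mu>"
        using borel_measurable_continuous_on_restrict[OF assms(11)[OF l]]
        by (simp add: measurable_cong_sets[OF sets_\<mu> refl])
      have "AE x in \<eta>. \<forall>j. AE \<omega> in \<mu>. \<omega> \<in> \<Omega> j \<longrightarrow> x + P l \<omega> \<notin> N"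
        using H l N by (simp add: AE_all_countable)
      then have avoid: "AE x in \<eta>. AE \<omega> in \<mu>. x + P l \<omega> \<notin> N"
      proof eventually_elim
        fix x assume "\<forall>j. AE \<omega> in \<mu>. \<omega> \<in> \<Omega> j \<longrightarrow> x + P l \<omega> \<notin> N"
        then have "AE \<omega> in \<mu>. \<forall>j. \<omega> \<in> \<Omega> j \<longrightarrow> x + P l \<omega> \<notin> N"
          by (rule AE_all_countable[THEN iffD2])
        with exhaust show "AE \<omega> in \<mu>. x + P l \<omega> \<notin> N" by eventually_elim auto
      qed
      have "emeasure (\<eta> \<star> \<nu> l) N = (\<integral>\<^sup>+x. \<integral>\<^sup>+y. indicator N (x + y) \<partial>\<nu> l \<partial>\<eta>)"
        using \<open>sets \<eta> = sets borel\<close> unfolding \<nu>_def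
        by (intro convolution_emeasure' M.finite_measure_distr E.finite_measure_axioms) auto
      also have "\<dots> = (\<integral>\<^sup>+x. \<integral>\<^sup>+\<omega>. indicator N (x + P l \<omega>) \<partial>\<mu> \<partial>\<eta>)"
        by (simp add: \<nu>_def nn_integral_distr)
      also have "\<dots> = (\<integral>\<^sup>+x. 0 \<partial>\<eta>)"
      proof (rule nn_integral_cong_AE)
        show "AE x in \<eta>. (\<integral>\<^sup>+\<omega>. indicator N (x + P l \<omega>) \<partial>\<mu>) = 0"
          using avoid
        proof eventually_elim
          fix x assume "AE \<omega> in \<mu>. x + P l \<omega> \<notin> N"
          then have "(\<integral>\<^sup>+\<omega>. indicator N (x + P l \<omega>) \<partial>\<mu>) = (\<integral>\<^sup>+\<omega>. 0 \<partial>\<mu>)"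
            by (intro nn_integral_cong_AE) auto
          then show "(\<integral>\<^sup>+\<omega>. indicator N (x + P l \<omega>) \<partial>\<mu>) = 0" by simp
        qed
      qed
      finally show "N \<in> null_sets (\<eta> \<star> \<nu> l)" by (intro null_setsI) auto
    qed
  qed
qed

end
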